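(* Let $C = C_1 \cup C_2 \subset \mathbb{P}^{2r+1}$ be a disjoint union of two complete intersections $C_1, C_2$ of dimension $r$. Then $I_C^m = I_C^{(m)}$ for all positive integers $m$.
   Context: $R = k[x_0,\ldots,x_{2r+1}]$ with $k$ an algebraically closed field of characteristic zero. $I_Z$ denotes the saturated homogeneous ideal of a subscheme $Z$; a complete intersection $C_i$ is a subscheme whose saturated ideal is generated by a regular sequence. For a nonzero homogeneous ideal $I$, $I^{(m)} = \bigcap_{\mathfrak{p} \in \mathrm{Ass}(I)} (I^m R_{\mathfrak{p}} \cap R)$. *)

theory Defs
  imports "HOL-Library.Poly_Mapping" "HOL-Computational_Algebra.Polynomial"
begin

definition is_ideal :: "'a::comm_ring_1 set \<Rightarrow> bool" where
  "is_ideal I \<longleftrightarrow> 0 \<in> I \<and> (\<forall>a\<in>I. \<forall>b\<in>I. a + b \<in> I) \<and> (\<forall>a\<in>I. \<forall>r. r * a \<in> I)"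

definition ideal_gen :: "'a::comm_ring_1 set \<Rightarrow> 'a set" where
  "ideal_gen S = \<Inter>{I. is_ideal I \<and> S \<subseteq> I}"

definition ideal_mult :: "'a::comm_ring_1 set \<Rightarrow> 'a set \<Rightarrow> 'a set" where
  "ideal_mult I J = ideal_gen {a * b | a b. a \<in> I \<and> b \<in> J}"

fun ideal_pow :: "'a::comm_ring_1 set \<Rightarrow> nat \<Rightarrow> 'a set" where
  "ideal_pow I 0 = UNIV"
| "ideal_pow I (Suc n) = ideal_mult I (ideal_pow I n)"

definition is_prime_ideal :: "'a::comm_ring_1 set \<Rightarrow> bool" where
  "is_prime_ideal P \<longleftrightarrow> is_ideal P \<and> P \<noteq> UNIV \<and> (\<forall>a b. a * b \<in> P \<longrightarrow> a \<in> P \<or> b \<in> P)"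

definition ass_primes :: "'a::comm_ring_1 set \<Rightarrow> 'a set set" where
  "ass_primes I = {P. is_prime_ideal P \<and> (\<exists>f. P = {g. g * f \<in> I})}"

text \<open>Contraction to R of the extension of J to the localization R_P:
  J R_P \<inter> R = {f. \<exists>s \<notin> P. s f \<in> J}.\<close>
definition loc_contract :: "'a::comm_ring_1 set \<Rightarrow> 'a set \<Rightarrow> 'a set" where
  "loc_contract J P = {f. \<exists>s. s \<notin> P \<and> s * f \<in> J}"

definition symbolic_pow :: "'a::comm_ring_1 set \<Rightarrow> nat \<Rightarrow> 'a set" where
  "symbolic_pow I m = (\<Inter>P\<in>ass_primes I. loc_contract (ideal_pow I m) P)"

definition regular_sequence :: "'a::comm_ring_1 list \<Rightarrow> bool" where
  "regular_sequence fs \<longleftrightarrow> ideal_gen (set fs) \<noteq> UNIV \<and>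
     (\<forall>i < length fs. \<forall>g. fs ! i * g \<in> ideal_gen (set (take i fs))
                           \<longrightarrow> g \<in> ideal_gen (set (take i fs)))"

definition prime_chain_above :: "'a::comm_ring_1 set \<Rightarrow> nat \<Rightarrow> bool" where
  "prime_chain_above J n \<longleftrightarrow> (\<exists>P :: nat \<Rightarrow> 'a set.
      J \<subseteq> P 0 \<and> (\<forall>i\<le>n. is_prime_ideal (P i)) \<and> (\<forall>i<n. P i \<subset> P (Suc i)))"

definition krull_dim_quot_eq :: "'a::comm_ring_1 set \<Rightarrow> nat \<Rightarrow> bool" where
  "krull_dim_quot_eq J d \<longleftrightarrow> prime_chain_above J d \<and> \<not> prime_chain_above J (Suc d)"

type_synonym ('v, 'k) mpoly = "('v \<Rightarrow>\<^sub>0 nat) \<Rightarrow>\<^sub>0 'k"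

definition var :: "'v \<Rightarrow> ('v, 'k::comm_ring_1) mpoly" where
  "var v = Poly_Mapping.single (Poly_Mapping.single v 1) 1"

definition mono_deg :: "('v::finite \<Rightarrow>\<^sub>0 nat) \<Rightarrow> nat" where
  "mono_deg \<mu> = (\<Sum>v\<in>UNIV. Poly_Mapping.lookup \<mu> v)"

definition homogeneous :: "('v::finite, 'k::comm_ring_1) mpoly \<Rightarrow> bool" where
  "homogeneous f \<longleftrightarrow> (\<exists>d. \<forall>\<mu>\<in>Poly_Mapping.keys f. mono_deg \<mu> = d)"

definition homogeneous_ideal :: "('v::finite, 'k::comm_ring_1) mpoly set \<Rightarrow> bool" where
  "homogeneous_ideal I \<longleftrightarrow> (\<exists>S. (\<forall>f\<in>S. homogeneous f) \<and> I = ideal_gen S)"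

definition irrelevant :: "('v::finite, 'k::comm_ring_1) mpoly set" where
  "irrelevant = ideal_gen (range var)"

definition saturation :: "('v::finite, 'k::comm_ring_1) mpoly set \<Rightarrow> ('v, 'k) mpoly set" where
  "saturation I = {f. \<exists>n. \<forall>g\<in>ideal_pow irrelevant n. g * f \<in> I}"

definition saturated_homogeneous :: "('v::finite, 'k::comm_ring_1) mpoly set \<Rightarrow> bool" where
  "saturated_homogeneous I \<longleftrightarrow> is_ideal I \<and> homogeneous_ideal I \<and> saturation I = I"

text \<open>J is the saturated ideal of a complete intersection subscheme of dimension r of
  P(k^'v): J is saturated homogeneous, generated by a regular sequence of homogeneous
  forms, and the projective subscheme has dimension r, i.e. dim R/J = r + 1.\<close>
definition complete_intersection_ideal :: "nat \<Rightarrow> ('v::finite, 'k::comm_ring_1) mpoly set \<Rightarrow> bool" where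
  "complete_intersection_ideal r J \<longleftrightarrow> saturated_homogeneous J \<and>
     (\<exists>fs. (\<forall>f\<in>set fs. homogeneous f) \<and> regular_sequence fs \<and> J = ideal_gen (set fs)) \<and>
     krull_dim_quot_eq J (r + 1)"

text \<open>Two subschemes with saturated ideals J1, J2 are disjoint iff the ideal
  J1 + J2 of their scheme-theoretic intersection has saturation equal to R.\<close>
definition disjoint_subschemes :: "('v::finite, 'k::comm_ring_1) mpoly set \<Rightarrow> ('v, 'k) mpoly set \<Rightarrow> bool" where
  "disjoint_subschemes J1 J2 \<longleftrightarrow> saturation (ideal_gen (J1 \<union> J2)) = UNIV"

definition alg_closed_field :: "'k::field itself \<Rightarrow> bool" where
  "alg_closed_field _ \<longleftrightarrow> (\<forall>p :: 'k poly. degree p \<ge> 1 \<longrightarrow> (\<exists>x. poly p x = 0))"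

end

theory Submission
  imports Defs "HOL-Library.FuncSet"
begin

text \<open>Let \<open>fs\<close>, \<open>gs\<close> be the regular sequences generating \<open>J1\<close>, \<open>J2\<close>. Since a polynomial ring in \<open>n\<close>
  variables has dimension at most \<open>n = 2 r + 2\<close>, each of them has length at most \<open>r + 1\<close>. By
  disjointness the ideal \<open>J1 + J2\<close> contains powers of all variables, so depth sensitivity of the
  Koszul complex and graded Nakayama show that the concatenation of \<open>fs\<close> and \<open>gs\<close> is again a regular
  sequence, in either order. Regular sequences being quasi-regular, the layers \<open>J1 ^ m / J1 ^ (m + 1)\<close>
  are free over \<open>R / J1\<close>. Consequently \<open>gs\<close> is regular on \<open>R / J1 ^ m\<close>, which gives
  \<open>J1 ^ m \<inter> J2 ^ m = J1 ^ m J2 ^ m\<close>, and \<open>J1 ^ m\<close> is unmixed with associated primes among those of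
  \<open>J1\<close>, none of which contains \<open>J2\<close>. The latter shows that the symbolic power of \<open>J1 \<inter> J2\<close> lies in
  \<open>J1 ^ m \<inter> J2 ^ m\<close>.\<close>

subsection \<open>Ideals and quasi-regularity\<close>

text \<open>The equality of 2r + 2 with the number of variables is what closes the argument. The
  dimension hypothesis supplies only an upper bound r + 1 for each length; the lower bound comes
  from disjointness, since 2r + 2 powers of variables form a regular sequence inside an ideal with
  at most 2r + 2 generators. For the same reason the concatenation has no higher Koszul homology, in
  whatever order it is arranged, whereas regularity itself is not visibly invariant under
  reordering; hence the detour through the complex. The return from acyclicity to regularity needs
  Nakayama, and positive degrees of the forms stand in for a local ring. Both orders are needed
  because an associated prime of one ideal is related to the intersection through an element of the
  other ideal that is regular modulo the first. The dimension bound rests on algebraic dependence: a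
  regular sequence followed by elements separating successive primes of a chain is a single flag,
  and more than n polynomials in n variables satisfy a relation that no flag admits.\<close>

lemma ideal_zero: "is_ideal I \<Longrightarrow> 0 \<in> I"
  by (simp add: is_ideal_def)

lemma ideal_add: "is_ideal I \<Longrightarrow> a \<in> I \<Longrightarrow> b \<in> I \<Longrightarrow> a + b \<in> I"
  by (simp add: is_ideal_def)

lemma ideal_mult_left: "is_ideal I \<Longrightarrow> a \<in> I \<Longrightarrow> r * a \<in> I"
  by (simp add: is_ideal_def)

lemma ideal_mult_right: "is_ideal I \<Longrightarrow> a \<in> I \<Longrightarrow> a * r \<in> I"
  by (simp add: is_ideal_def mult.commute)

lemma ideal_uminus: "is_ideal I \<Longrightarrow> a \<in> I \<Longrightarrow> - a \<in> I"
  using ideal_mult_left[of I a "-1"] by simp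

lemma ideal_diff: "is_ideal I \<Longrightarrow> a \<in> I \<Longrightarrow> b \<in> I \<Longrightarrow> a - b \<in> I"
  using ideal_add[of I a "-b"] ideal_uminus[of I b] by simp

lemma ideal_sum: "is_ideal I \<Longrightarrow> (\<And>x. x \<in> A \<Longrightarrow> f x \<in> I) \<Longrightarrow> sum f A \<in> I"
  by (induction A rule: infinite_finite_induct) (auto simp: ideal_zero ideal_add)

lemmas ideal_closed = ideal_zero ideal_add ideal_diff ideal_uminus ideal_mult_left ideal_mult_right

lemma is_ideal_UNIV [simp]: "is_ideal UNIV"
  by (simp add: is_ideal_def)

lemma is_ideal_Inter: "(\<And>I. I \<in> S \<Longrightarrow> is_ideal I) \<Longrightarrow> is_ideal (\<Inter>S)"
  by (simp add: is_ideal_def)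

lemma is_ideal_zero [simp]: "is_ideal {0}"
  by (simp add: is_ideal_def)

lemma is_ideal_colon: "is_ideal I \<Longrightarrow> is_ideal {a. a * x \<in> I}"
  by (auto simp: is_ideal_def distrib_right mult.assoc)

lemma ideal_UNIV_iff: "is_ideal I \<Longrightarrow> I = UNIV \<longleftrightarrow> 1 \<in> I"
  using ideal_mult_left[of I 1] by auto

lemma is_ideal_gen [simp]: "is_ideal (ideal_gen S)"
  unfolding ideal_gen_def by (rule is_ideal_Inter) auto

lemma ideal_gen_superset: "S \<subseteq> ideal_gen S"
  unfolding ideal_gen_def by auto

lemma in_ideal_genI: "x \<in> S \<Longrightarrow> x \<in> ideal_gen S"
  using ideal_gen_superset by auto

lemma ideal_gen_minimal: "is_ideal I \<Longrightarrow> S \<subseteq> I \<Longrightarrow> ideal_gen S \<subseteq> I"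
  unfolding ideal_gen_def by auto

lemma ideal_gen_mono: "S \<subseteq> T \<Longrightarrow> ideal_gen S \<subseteq> ideal_gen T"
  by (meson ideal_gen_minimal ideal_gen_superset is_ideal_gen order_trans)

lemma ideal_gen_ideal: "is_ideal I \<Longrightarrow> ideal_gen I = I"
  by (simp add: ideal_gen_minimal ideal_gen_superset subset_antisym)

lemma ideal_gen_empty [simp]: "ideal_gen {} = {0}"
  using ideal_gen_minimal[of "{0}" "{}"] ideal_zero[OF is_ideal_gen, of "{}"] by auto

lemma ideal_gen_gen_Un: "ideal_gen (ideal_gen S \<union> T) = ideal_gen (S \<union> T)"
proof (rule subset_antisym)
  show "ideal_gen (ideal_gen S \<union> T) \<subseteq> ideal_gen (S \<union> T)"
    by (intro ideal_gen_minimal Un_least ideal_gen_mono) (auto intro: in_ideal_genI)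
  show "ideal_gen (S \<union> T) \<subseteq> ideal_gen (ideal_gen S \<union> T)"
    by (intro ideal_gen_mono) (auto intro: in_ideal_genI)
qed

lemma ideal_gen_Un_gen: "ideal_gen (S \<union> ideal_gen T) = ideal_gen (S \<union> T)"
  by (metis Un_commute ideal_gen_gen_Un)

lemma ideal_gen_Un:
  "x \<in> ideal_gen (S \<union> T) \<longleftrightarrow> (\<exists>a\<in>ideal_gen S. \<exists>b\<in>ideal_gen T. x = a + b)"
proof
  let ?K = "{a + b | a b. a \<in> ideal_gen S \<and> b \<in> ideal_gen T}"
  have "is_ideal ?K"
    unfolding is_ideal_def
  proof (intro conjI ballI allI)
    show "0 \<in> ?K"
      using ideal_zero[OF is_ideal_gen] by force
    fix x y assume "x \<in> ?K" "y \<in> ?K"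
    then obtain a b c d where "x = a + b" "y = c + d" "a \<in> ideal_gen S" "b \<in> ideal_gen T"
      "c \<in> ideal_gen S" "d \<in> ideal_gen T" by blast
    then have "x + y = (a + c) + (b + d)" "a + c \<in> ideal_gen S" "b + d \<in> ideal_gen T"
      by (simp_all add: ideal_add)
    then show "x + y \<in> ?K" by blast
  next
    fix x r assume "x \<in> ?K"
    then obtain a b where "x = a + b" "a \<in> ideal_gen S" "b \<in> ideal_gen T" by blast
    then have "r * x = r * a + r * b" "r * a \<in> ideal_gen S" "r * b \<in> ideal_gen T"
      by (simp_all add: ideal_mult_left distrib_left)
    then show "r * x \<in> ?K" by blast
  qed
  moreover have "S \<union> T \<subseteq> ?K"
  proof
    fix x assume "x \<in> S \<union> T"
    moreover have "x = x + 0" "x = 0 + x" by simp_all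
    ultimately show "x \<in> ?K"
      using ideal_zero[OF is_ideal_gen, of S] ideal_zero[OF is_ideal_gen, of T]
        in_ideal_genI[of x S] in_ideal_genI[of x T] by blast
  qed
  ultimately have "ideal_gen (S \<union> T) \<subseteq> ?K" by (rule ideal_gen_minimal)
  then show "x \<in> ideal_gen (S \<union> T) \<Longrightarrow> \<exists>a\<in>ideal_gen S. \<exists>b\<in>ideal_gen T. x = a + b" by blast
next
  assume "\<exists>a\<in>ideal_gen S. \<exists>b\<in>ideal_gen T. x = a + b"
  then show "x \<in> ideal_gen (S \<union> T)"
    by (metis ideal_add ideal_gen_mono in_mono is_ideal_gen sup_ge1 sup_ge2)
qed

lemma ideal_gen_singleton: "ideal_gen {g} = {r * g | r. True}"
proof (rule subset_antisym)
  have "is_ideal {r * g | r. True}"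
    by (auto simp: is_ideal_def mult.assoc[symmetric] distrib_right[symmetric] intro: exI[of _ 0])
  moreover have "g = 1 * g" by simp
  then have "g \<in> {r * g | r. True}" by blast
  ultimately show "ideal_gen {g} \<subseteq> {r * g | r. True}"
    by (intro ideal_gen_minimal) auto
  show "{r * g | r. True} \<subseteq> ideal_gen {g}"
    by (auto intro!: ideal_mult_left[OF is_ideal_gen] intro: in_ideal_genI)
qed

lemma ideal_gen_insert:
  "x \<in> ideal_gen (insert g S) \<longleftrightarrow> (\<exists>a\<in>ideal_gen S. \<exists>r. x = a + r * g)"
  using ideal_gen_Un[of x S "{g}"] by (auto simp: ideal_gen_singleton)

lemma sum_lessThan_add:
  fixes f :: "nat \<Rightarrow> 'b::comm_monoid_add"
  shows "(\<Sum>i<m + n. f i) = (\<Sum>i<m. f i) + (\<Sum>i<n. f (m + i))"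
  by (induction n) (simp_all add: add.assoc)

lemma ideal_gen_list:
  "x \<in> ideal_gen (set es) \<longleftrightarrow> (\<exists>c. x = (\<Sum>i<length es. c i * es ! i))"
proof
  let ?K = "{x. \<exists>c. x = (\<Sum>i<length es. c i * es ! i)}"
  have "is_ideal ?K"
    unfolding is_ideal_def
  proof (intro conjI ballI allI)
    show "0 \<in> ?K" by (auto intro!: exI[of _ "\<lambda>_. 0"])
    fix x y assume "x \<in> ?K" "y \<in> ?K"
    then obtain c d where "x = (\<Sum>i<length es. c i * es ! i)" "y = (\<Sum>i<length es. d i * es ! i)"
      by blast
    then show "x + y \<in> ?K"
      by (auto intro!: exI[of _ "\<lambda>i. c i + d i"] simp: sum.distrib distrib_right)
  next
    fix x r assume "x \<in> ?K"
    then obtain c where "x = (\<Sum>i<length es. c i * es ! i)" by blast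
    then show "r * x \<in> ?K"
      by (auto intro!: exI[of _ "\<lambda>i. r * c i"] simp: sum_distrib_left mult.assoc)
  qed
  moreover have "set es \<subseteq> ?K"
  proof
    fix e assume "e \<in> set es"
    then obtain j where "j < length es" "e = es ! j" by (auto simp: in_set_conv_nth)
    then have "e = (\<Sum>i<length es. (if i = j then 1 else 0) * es ! i)"
      by (simp add: if_distrib[of "\<lambda>x. x * _"] cong: if_cong)
    then show "e \<in> ?K" by (auto intro!: exI[of _ "\<lambda>i. if i = j then 1 else 0"])
  qed
  ultimately have "ideal_gen (set es) \<subseteq> ?K" by (rule ideal_gen_minimal)
  then show "x \<in> ideal_gen (set es) \<Longrightarrow> \<exists>c. x = (\<Sum>i<length es. c i * es ! i)" by blast
next
  assume "\<exists>c. x = (\<Sum>i<length es. c i * es ! i)"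
  then show "x \<in> ideal_gen (set es)"
    by (fastforce intro: ideal_sum[OF is_ideal_gen] ideal_mult_left[OF is_ideal_gen] in_ideal_genI)
qed

section \<open>Products and powers of ideals\<close>

lemma is_ideal_mult [simp]: "is_ideal (ideal_mult I J)"
  by (simp add: ideal_mult_def)

lemma is_ideal_pow [simp]: "is_ideal (ideal_pow I n)"
  by (cases n) simp_all

lemma ideal_multI: "a \<in> I \<Longrightarrow> b \<in> J \<Longrightarrow> a * b \<in> ideal_mult I J"
  unfolding ideal_mult_def by (rule in_ideal_genI) auto

lemma ideal_mult_subset:
  "is_ideal K \<Longrightarrow> (\<And>a b. a \<in> I \<Longrightarrow> b \<in> J \<Longrightarrow> a * b \<in> K) \<Longrightarrow> ideal_mult I J \<subseteq> K"
  unfolding ideal_mult_def by (rule ideal_gen_minimal) auto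

lemma ideal_mult_subset_left: "is_ideal I \<Longrightarrow> ideal_mult I J \<subseteq> I"
  by (rule ideal_mult_subset) (auto intro: ideal_mult_right)

lemma ideal_mult_subset_right: "is_ideal J \<Longrightarrow> ideal_mult I J \<subseteq> J"
  by (rule ideal_mult_subset) (auto intro: ideal_mult_left)

lemma ideal_mult_mono: "I \<subseteq> I' \<Longrightarrow> J \<subseteq> J' \<Longrightarrow> ideal_mult I J \<subseteq> ideal_mult I' J'"
  by (rule ideal_mult_subset) (auto intro: ideal_multI)

lemma ideal_mult_assoc_subset: "ideal_mult (ideal_mult I J) K \<subseteq> ideal_mult I (ideal_mult J K)"
proof (rule ideal_mult_subset[OF is_ideal_mult])
  fix x k assume "x \<in> ideal_mult I J" "k \<in> K"
  have "is_ideal {x. x * k \<in> ideal_mult I (ideal_mult J K)}"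
    by (rule is_ideal_colon) simp
  then have "ideal_mult I J \<subseteq> {x. x * k \<in> ideal_mult I (ideal_mult J K)}"
    by (rule ideal_mult_subset) (auto simp: mult.assoc \<open>k \<in> K\<close> intro!: ideal_multI)
  then show "x * k \<in> ideal_mult I (ideal_mult J K)"
    using \<open>x \<in> ideal_mult I J\<close> by blast
qed

lemma ideal_mult_list:
  assumes "is_ideal I"
  shows "x \<in> ideal_mult I (ideal_gen (set es)) \<longleftrightarrow>
    (\<exists>c. (\<forall>i<length es. c i \<in> I) \<and> x = (\<Sum>i<length es. c i * es ! i))"
proof
  let ?K = "{x. \<exists>c. (\<forall>i<length es. c i \<in> I) \<and> x = (\<Sum>i<length es. c i * es ! i)}"
  have "is_ideal ?K"
    unfolding is_ideal_def
  proof (intro conjI ballI allI)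
    show "0 \<in> ?K" by (auto intro!: exI[of _ "\<lambda>_. 0"] ideal_zero assms)
    fix x y assume "x \<in> ?K" "y \<in> ?K"
    then obtain c d where "x = (\<Sum>i<length es. c i * es ! i)" "y = (\<Sum>i<length es. d i * es ! i)"
      "\<forall>i<length es. c i \<in> I" "\<forall>i<length es. d i \<in> I"
      by blast
    then show "x + y \<in> ?K"
      by (auto intro!: exI[of _ "\<lambda>i. c i + d i"] ideal_add assms simp: sum.distrib distrib_right)
  next
    fix x r assume "x \<in> ?K"
    then obtain c where "x = (\<Sum>i<length es. c i * es ! i)" "\<forall>i<length es. c i \<in> I" by blast
    then show "r * x \<in> ?K"
      by (auto intro!: exI[of _ "\<lambda>i. r * c i"] ideal_mult_left assms simp: sum_distrib_left mult.assoc)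
  qed
  moreover have "a * b \<in> ?K" if "a \<in> I" "b \<in> ideal_gen (set es)" for a b
  proof -
    obtain c where "b = (\<Sum>i<length es. c i * es ! i)"
      using \<open>b \<in> _\<close> by (auto simp: ideal_gen_list)
    then show ?thesis
      using \<open>a \<in> I\<close> by (auto intro!: exI[of _ "\<lambda>i. a * c i"] ideal_mult_right assms
          simp: sum_distrib_left mult.assoc)
  qed
  ultimately have "ideal_mult I (ideal_gen (set es)) \<subseteq> ?K" by (rule ideal_mult_subset)
  then show "x \<in> ideal_mult I (ideal_gen (set es)) \<Longrightarrow>
      \<exists>c. (\<forall>i<length es. c i \<in> I) \<and> x = (\<Sum>i<length es. c i * es ! i)" by blast
next
  assume "\<exists>c. (\<forall>i<length es. c i \<in> I) \<and> x = (\<Sum>i<length es. c i * es ! i)"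
  then show "x \<in> ideal_mult I (ideal_gen (set es))"
    by (auto intro!: ideal_sum ideal_multI in_ideal_genI)
qed

lemma ideal_pow_Suc_subset: "ideal_pow J (Suc m) \<subseteq> ideal_pow J m"
  by (simp add: ideal_mult_subset_right)

lemma ideal_pow_mono: "I \<subseteq> J \<Longrightarrow> ideal_pow I m \<subseteq> ideal_pow J m"
  by (induction m) (simp_all add: ideal_mult_mono)

lemma ideal_pow_antimono: "i \<le> m \<Longrightarrow> ideal_pow J m \<subseteq> ideal_pow J i"
  by (rule lift_Suc_antimono_le[of "ideal_pow J"]) (rule ideal_pow_Suc_subset)

lemma ideal_pow_one: "is_ideal J \<Longrightarrow> ideal_pow J (Suc 0) = J"
  using ideal_mult_subset_left[of J UNIV] ideal_multI[of _ J 1 UNIV] by auto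

lemma power_in_ideal_pow: "x \<in> I \<Longrightarrow> x ^ n \<in> ideal_pow I n"
  by (induction n) (auto intro: ideal_multI)

lemma ideal_pow_mult_subset:
  assumes "\<And>x y. x \<in> I \<Longrightarrow> y \<in> J \<Longrightarrow> x * y \<in> K"
  shows "ideal_mult (ideal_pow I m) (ideal_pow J m) \<subseteq> ideal_pow K m"
proof (induction m)
  case (Suc m)
  show ?case
  proof (rule ideal_mult_subset[OF is_ideal_pow])
    fix a b assume a: "a \<in> ideal_pow I (Suc m)" and b: "b \<in> ideal_pow J (Suc m)"
    have *: "x * a' * b \<in> ideal_pow K (Suc m)"
      if x: "x \<in> I" and a': "a' \<in> ideal_pow I m" for x a'
    proof -
      have "is_ideal {b. b * (x * a') \<in> ideal_pow K (Suc m)}"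
        by (rule is_ideal_colon) simp
      then have "ideal_mult J (ideal_pow J m) \<subseteq> {b. b * (x * a') \<in> ideal_pow K (Suc m)}"
      proof (rule ideal_mult_subset)
        fix y b' assume "y \<in> J" "b' \<in> ideal_pow J m"
        then have "(x * y) * (a' * b') \<in> ideal_mult K (ideal_pow K m)"
          using Suc.IH x a' assms by (intro ideal_multI) (auto intro: ideal_multI)
        then show "y * b' \<in> {b. b * (x * a') \<in> ideal_pow K (Suc m)}"
          by (simp add: mult_ac)
      qed
      then show ?thesis using b by (auto simp: mult_ac)
    qed
    have "ideal_mult I (ideal_pow I m) \<subseteq> {a. a * b \<in> ideal_pow K (Suc m)}"
      using * by (intro ideal_mult_subset is_ideal_colon is_ideal_pow) auto
    then show "a * b \<in> ideal_pow K (Suc m)" using a by auto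
  qed
qed simp

section \<open>Regular sequences without the properness condition\<close>

text \<open>Sequences are stored in reverse: the head of the list is the last element, and it is a
  nonzerodivisor modulo \<open>I\<close> and the tail. Unlike a regular sequence, the quotient may vanish.\<close>
fun weakly_regular :: "'a::comm_ring_1 set \<Rightarrow> 'a list \<Rightarrow> bool" where
  "weakly_regular I [] \<longleftrightarrow> True"
| "weakly_regular I (g # gs) \<longleftrightarrow> weakly_regular I gs \<and>
     (\<forall>u. g * u \<in> ideal_gen (I \<union> set gs) \<longrightarrow> u \<in> ideal_gen (I \<union> set gs))"

lemma weakly_regular_ConsD:
  "weakly_regular I (g # gs) \<Longrightarrow> g * u \<in> ideal_gen (I \<union> set gs) \<Longrightarrow> u \<in> ideal_gen (I \<union> set gs)"
  by (simp only: weakly_regular.simps)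

text \<open>Lists being reversed, \<open>fs\<close> is the earlier part of \<open>gs @ fs\<close>.
  This turns regularity of a concatenation into regularity of \<open>gs\<close> on the quotient by
  \<open>fs\<close>.\<close>

lemma weakly_regular_append:
  "weakly_regular I (gs @ fs) \<longleftrightarrow>
    weakly_regular I fs \<and> weakly_regular (ideal_gen (I \<union> set fs)) gs"
proof -
  have "ideal_gen (ideal_gen (I \<union> set fs) \<union> set gs) = ideal_gen (I \<union> (set gs \<union> set fs))" for gs
    by (simp only: ideal_gen_gen_Un) (simp add: Un_ac)
  then show ?thesis by (induction gs) auto
qed

lemma regular_sequence_imp_weakly_regular:
  assumes "regular_sequence fs"
  shows "weakly_regular {} (rev fs)"
proof -
  have "weakly_regular {} (rev (take i fs))" if "i \<le> length fs" for i
    using that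
  proof (induction i)
    case (Suc i)
    then show ?case
      using assms by (simp add: take_Suc_conv_app_nth regular_sequence_def)
  qed simp
  from this[of "length fs"] show ?thesis by simp
qed

text \<open>An elementary form of \<open>Tor_1(R/I, R/K) = 0\<close> for \<open>K\<close> generated
  by \<open>gs\<close>. If \<open>x + c * g\<close> lies in \<open>I\<close>, then
  \<open>g * c\<close> vanishes modulo \<open>I\<close> and the tail, so \<open>c = a + b\<close>
  with \<open>a\<close> in \<open>I\<close> and \<open>b\<close> in the ideal of the tail.
  Subtracting \<open>a * g\<close>, which already lies in the product, leaves an element of
  \<open>I\<close> and of the ideal of the tail.\<close>

lemma weakly_regular_Int:
  assumes "is_ideal I" "weakly_regular I gs"
  shows "I \<inter> ideal_gen (set gs) \<subseteq> ideal_mult I (ideal_gen (set gs))"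
  using assms(2)
proof (induction gs)
  case Nil
  then show ?case by (auto intro: ideal_zero)
next
  case (Cons g gs)
  show ?case
  proof
    fix u assume "u \<in> I \<inter> ideal_gen (set (g # gs))"
    then obtain x c where u: "u \<in> I" "u = x + c * g" and x: "x \<in> ideal_gen (set gs)"
      by (auto simp: ideal_gen_insert)
    have "g * c = u + (- x)" using u by (simp add: algebra_simps)
    moreover have "- x \<in> ideal_gen (set gs)" using x by (simp add: ideal_uminus)
    ultimately have "g * c \<in> ideal_gen (I \<union> set gs)"
      using u(1) unfolding ideal_gen_Un ideal_gen_ideal[OF assms(1)] by blast
    then have "c \<in> ideal_gen (I \<union> set gs)" by (rule weakly_regular_ConsD[OF Cons.prems])
    then obtain a b where c: "c = a + b" and a: "a \<in> I" and b: "b \<in> ideal_gen (set gs)"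
      by (auto simp: ideal_gen_Un ideal_gen_ideal[OF assms(1)])
    have "u - a * g = b * g + x" using u c by (simp add: algebra_simps)
    moreover have "b * g + x \<in> ideal_gen (set gs)"
      using b x by (auto intro!: ideal_add ideal_mult_right)
    moreover have "u - a * g \<in> I" using u a assms(1) by (auto intro!: ideal_diff ideal_mult_right)
    ultimately have "u - a * g \<in> ideal_mult I (ideal_gen (set gs))" using Cons by auto
    also have "\<dots> \<subseteq> ideal_mult I (ideal_gen (set (g # gs)))"
      by (intro ideal_mult_mono ideal_gen_mono) auto
    finally have "u - a * g \<in> ideal_mult I (ideal_gen (set (g # gs)))" .
    moreover have "a * g \<in> ideal_mult I (ideal_gen (set (g # gs)))"
      using a by (auto intro!: ideal_multI in_ideal_genI)
    ultimately have "(u - a * g) + a * g \<in> ideal_mult I (ideal_gen (set (g # gs)))"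
      by (intro ideal_add) auto
    then show "u \<in> ideal_mult I (ideal_gen (set (g # gs)))" by simp
  qed
qed

section \<open>Layers of the powers of an ideal: quasi-regularity\<close>

text \<open>\<open>J ^ m / J ^ (m + 1)\<close> is free over \<open>R / J\<close> on the classes of \<open>es\<close>.\<close>
definition free_layer :: "'a::comm_ring_1 set \<Rightarrow> nat \<Rightarrow> 'a list \<Rightarrow> bool" where
  "free_layer J m es \<longleftrightarrow> ideal_pow J m = ideal_gen (set es) \<and>
     (\<forall>c. (\<Sum>i<length es. c i * es ! i) \<in> ideal_pow J (Suc m) \<longrightarrow> (\<forall>i<length es. c i \<in> J))"

lemma free_layerD:
  "free_layer J m es \<Longrightarrow> (\<Sum>i<length es. c i * es ! i) \<in> ideal_pow J (Suc m) \<Longrightarrow>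
    i < length es \<Longrightarrow> c i \<in> J"
  unfolding free_layer_def by blast

lemma free_layer_0: "is_ideal J \<Longrightarrow> free_layer J 0 [1]"
  using ideal_UNIV_iff[OF is_ideal_gen, of "{1}"]
  by (auto simp: free_layer_def in_ideal_genI ideal_pow_one simp del: ideal_pow.simps(2))

lemma free_layer_sum:
  assumes "free_layer J m es" "u \<in> ideal_pow J m"
  obtains c where "u = (\<Sum>i<length es. c i * es ! i)"
  using assms by (auto simp: free_layer_def ideal_gen_list)

text \<open>Freeness over \<open>R/J\<close> descends to its quotient \<open>R/L\<close>: two
  expansions of the same element differ by a relation, whose coefficients lie in \<open>J\<close>
  and hence in \<open>L\<close>.\<close>

lemma free_layer_coeff:
  assumes fl: "free_layer J m es" and J: "is_ideal J" and L: "is_ideal L" "J \<subseteq> L"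
    and sum: "(\<Sum>i<length es. c i * es ! i) \<in> ideal_mult L (ideal_pow J m)" and i: "i < length es"
  shows "c i \<in> L"
proof -
  have "ideal_pow J m = ideal_gen (set es)" using fl by (simp add: free_layer_def)
  then obtain d where d: "\<forall>i<length es. d i \<in> L"
    and eq: "(\<Sum>i<length es. c i * es ! i) = (\<Sum>i<length es. d i * es ! i)"
    using sum by (auto simp: ideal_mult_list[OF L(1)])
  have "(\<Sum>i<length es. (c i - d i) * es ! i) = 0"
    using eq by (simp add: left_diff_distrib sum_subtractf)
  then have "(\<Sum>i<length es. (c i - d i) * es ! i) \<in> ideal_pow J (Suc m)"
    by (simp add: ideal_zero del: ideal_pow.simps)
  then have "c i - d i \<in> J" using fl i by (auto simp: free_layer_def)
  then have "(c i - d i) + d i \<in> L" using d i L by (intro ideal_add) auto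
  then show ?thesis by simp
qed

lemma free_layer_sum_in:
  assumes fl: "free_layer J m es" and L: "is_ideal L"
    and c: "\<And>i. i < length es \<Longrightarrow> c i \<in> L"
  shows "(\<Sum>i<length es. c i * es ! i) \<in> ideal_mult L (ideal_pow J m)"
proof -
  have "ideal_pow J m = ideal_gen (set es)" using fl by (simp add: free_layer_def)
  then show ?thesis using c by (auto simp: ideal_mult_list[OF L])
qed

text \<open>The module \<open>J ^ m / L J ^ m\<close> is free over \<open>R/L\<close>, so a
  nonzerodivisor on \<open>R/L\<close> can be cancelled there coefficient by coefficient.\<close>

lemma free_layer_cancel:
  assumes fl: "free_layer J m es" and J: "is_ideal J" and L: "is_ideal L" "J \<subseteq> L"
    and reg: "\<And>u. g * u \<in> L \<Longrightarrow> u \<in> L"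
    and u: "u \<in> ideal_pow J m" "g * u \<in> ideal_mult L (ideal_pow J m)"
  shows "u \<in> ideal_mult L (ideal_pow J m)"
proof -
  obtain c where c: "u = (\<Sum>i<length es. c i * es ! i)" using free_layer_sum[OF fl u(1)] .
  have "g * u = (\<Sum>i<length es. (g * c i) * es ! i)"
    by (simp add: c sum_distrib_left mult.assoc)
  then have "(\<Sum>i<length es. (g * c i) * es ! i) \<in> ideal_mult L (ideal_pow J m)"
    using u(2) by simp
  then have "c i \<in> L" if "i < length es" for i
    using that by (rule reg[OF free_layer_coeff[OF fl J L]])
  then show ?thesis unfolding c by (rule free_layer_sum_in[OF fl L(1)])
qed

text \<open>The quotient by \<open>J ^ m\<close> is filtered by the layers; each layer is climbed by
  \<open>free_layer_cancel\<close> with \<open>L = J\<close>.\<close>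

lemma regular_mod_pow:
  assumes fl: "\<And>m. \<exists>es. free_layer J m es" and J: "is_ideal J"
    and reg: "\<And>u. g * u \<in> J \<Longrightarrow> u \<in> J" and "g * u \<in> ideal_pow J m"
  shows "u \<in> ideal_pow J m"
  using assms(4)
proof (induction m)
  case (Suc m)
  then have u: "u \<in> ideal_pow J m" using ideal_pow_Suc_subset by blast
  have gu: "g * u \<in> ideal_mult J (ideal_pow J m)" using Suc.prems by simp
  obtain es where es: "free_layer J m es" using fl by blast
  have "u \<in> ideal_mult J (ideal_pow J m)"
    by (rule free_layer_cancel[OF es J J order_refl _ u gu]) (rule reg)
  then show ?case by simp
qed simp

text \<open>Expand a product of m + 1 factors from \<open>J + (g)\<close>: either no factor
  contributes \<open>g\<close>, or one \<open>g\<close> can be pulled out and m factors from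
  \<open>K\<close> remain.\<close>

lemma ideal_pow_insert:
  fixes fs :: "'a::comm_ring_1 list" and g :: 'a
  defines "J \<equiv> ideal_gen (set fs)" and "K \<equiv> ideal_gen (set (g # fs))"
  assumes "x \<in> ideal_pow K (Suc m)"
  obtains a b where "a \<in> ideal_pow J (Suc m)" "b \<in> ideal_pow K m" "x = a + g * b"
proof -
  have JK: "J \<subseteq> K" unfolding J_def K_def by (rule ideal_gen_mono) auto
  have g: "g \<in> K" unfolding K_def by (rule in_ideal_genI) auto
  have ideal: "is_ideal {a + g * b | a b. a \<in> ideal_pow J n \<and> b \<in> ideal_pow K m}" (is "is_ideal (?S n m)")
    for n m
    unfolding is_ideal_def
  proof (intro conjI ballI allI)
    show "0 \<in> ?S n m" using ideal_zero[of "ideal_pow J n"] ideal_zero[of "ideal_pow K m"] by force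
    fix x y assume "x \<in> ?S n m" "y \<in> ?S n m"
    then obtain a b c d where "x = a + g * b" "y = c + g * d" "a \<in> ideal_pow J n" "b \<in> ideal_pow K m"
      "c \<in> ideal_pow J n" "d \<in> ideal_pow K m" by blast
    then have "x + y = (a + c) + g * (b + d)" "a + c \<in> ideal_pow J n" "b + d \<in> ideal_pow K m"
      by (simp_all add: ideal_add algebra_simps)
    then show "x + y \<in> ?S n m" by blast
  next
    fix x r assume "x \<in> ?S n m"
    then obtain a b where "x = a + g * b" "a \<in> ideal_pow J n" "b \<in> ideal_pow K m" by blast
    then have "r * x = r * a + g * (r * b)" "r * a \<in> ideal_pow J n" "r * b \<in> ideal_pow K m"
      using ideal_mult_left[OF is_ideal_pow] by (simp_all add: distrib_left mult.left_commute)
    then show "r * x \<in> ?S n m" by blast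
  qed
  have "ideal_pow K (Suc m) \<subseteq> ?S (Suc m) m"
  proof (induction m)
    case 0
    have JJ: "ideal_pow J (Suc 0) = J" and KK: "ideal_pow K (Suc 0) = K"
      by (simp_all add: ideal_pow_one J_def K_def del: ideal_pow.simps)
    show ?case
    proof
      fix x assume "x \<in> ideal_pow K (Suc 0)"
      then have "x \<in> K" by (simp only: KK)
      then obtain a r where "a \<in> J" "x = a + g * r"
        unfolding K_def J_def by (auto simp: ideal_gen_insert mult.commute)
      then show "x \<in> ?S (Suc 0) 0" unfolding JJ by auto
    qed
  next
    case (Suc m)
    have "ideal_mult K (ideal_pow K (Suc m)) \<subseteq> ?S (Suc (Suc m)) (Suc m)"
    proof (rule ideal_mult_subset[OF ideal])
      fix x y assume x: "x \<in> K" and y: "y \<in> ideal_pow K (Suc m)"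
      obtain a r where a: "a \<in> J" "x = a + r * g" using x
        unfolding K_def J_def by (auto simp: ideal_gen_insert)
      obtain c d where c: "c \<in> ideal_pow J (Suc m)" "d \<in> ideal_pow K m" "y = c + g * d"
        using Suc y by blast
      have "x * y = a * c + g * (a * d + r * y)" using a c by (simp add: algebra_simps)
      moreover have "a * c \<in> ideal_pow J (Suc (Suc m))"
        using ideal_multI[of a J c "ideal_pow J (Suc m)"] a c by simp
      moreover have "a * d \<in> ideal_pow K (Suc m)"
        using ideal_multI[of a K d "ideal_pow K m"] a c JK by auto
      then have "a * d + r * y \<in> ideal_pow K (Suc m)"
        using ideal_mult_left[OF is_ideal_pow y, of r] by (intro ideal_add is_ideal_pow)
      ultimately show "x * y \<in> ?S (Suc (Suc m)) (Suc m)" by blast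
    qed
    then show ?case by (subst (1) ideal_pow.simps)
  qed
  then show thesis using assms(3) that by blast
qed

lemma free_layer_Cons:
  fixes fs :: "'a::comm_ring_1 list" and g :: 'a
  defines "J \<equiv> ideal_gen (set fs)" and "K \<equiv> ideal_gen (set (g # fs))"
  assumes fl: "\<And>m. \<exists>es. free_layer J m es" and reg: "\<And>u. g * u \<in> J \<Longrightarrow> u \<in> J"
  shows "\<exists>es. free_layer K m es"
proof (induction m)
  case 0
  show ?case unfolding K_def using free_layer_0[OF is_ideal_gen] by blast
next
  case (Suc m)
  have JK: "J \<subseteq> K" unfolding J_def K_def by (rule ideal_gen_mono) auto
  have g: "g \<in> K" unfolding K_def by (rule in_ideal_genI) auto
  have idJ: "is_ideal J" and idK: "is_ideal K" by (simp_all add: J_def K_def)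
  obtain es where es: "free_layer K m es" using Suc by blast
  obtain ds where ds: "free_layer J (Suc m) ds" using fl by blast
  have powJ: "ideal_pow J (Suc m) = ideal_gen (set ds)" using ds by (simp add: free_layer_def)
  have powK: "ideal_pow K m = ideal_gen (set es)" using es by (simp add: free_layer_def)
  \<comment> \<open>These correspond to the monomials of degree m + 1 in the enlarged sequence:
    those without \<open>g\<close>, then \<open>g\<close> times those of degree m.\<close>
  let ?bs = "ds @ map ((*) g) es"
  have split: "(\<Sum>i<length ?bs. c i * ?bs ! i) =
      (\<Sum>i<length ds. c i * ds ! i) + g * (\<Sum>i<length es. c (length ds + i) * es ! i)" for c
    by (simp add: sum_lessThan_add nth_append sum_distrib_left mult_ac)
  have "ideal_pow K (Suc m) = ideal_gen (set ?bs)"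
  proof (rule subset_antisym)
    show "ideal_pow K (Suc m) \<subseteq> ideal_gen (set ?bs)"
    proof
      fix x assume "x \<in> ideal_pow K (Suc m)"
      then obtain a b where a: "a \<in> ideal_pow J (Suc m)" and b: "b \<in> ideal_pow K m" and x: "x = a + g * b"
        unfolding K_def J_def by (rule ideal_pow_insert)
      obtain c d where "a = (\<Sum>i<length ds. c i * ds ! i)" "b = (\<Sum>i<length es. d i * es ! i)"
        using a b powJ powK by (auto simp: ideal_gen_list simp del: ideal_pow.simps)
      then have "x = (\<Sum>i<length ?bs. (if i < length ds then c i else d (i - length ds)) * ?bs ! i)"
        unfolding x split by simp
      then show "x \<in> ideal_gen (set ?bs)"
        unfolding ideal_gen_list
        by (intro exI[of _ "\<lambda>i. if i < length ds then c i else d (i - length ds)"])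
    qed
    have "set ds \<subseteq> ideal_pow J (Suc m)" unfolding powJ by (rule ideal_gen_superset)
    also have "\<dots> \<subseteq> ideal_pow K (Suc m)" by (rule ideal_pow_mono[OF JK])
    finally have "set ds \<subseteq> ideal_pow K (Suc m)" .
    moreover have "(*) g ` set es \<subseteq> ideal_pow K (Suc m)"
      using g by (auto simp: powK intro!: ideal_multI in_ideal_genI)
    ultimately show "ideal_gen (set ?bs) \<subseteq> ideal_pow K (Suc m)"
      by (intro ideal_gen_minimal is_ideal_pow) auto
  qed
  moreover have "c i \<in> K" if sum: "(\<Sum>i<length ?bs. c i * ?bs ! i) \<in> ideal_pow K (Suc (Suc m))"
    and i: "i < length ?bs" for c i
  proof -
    define F where "F = (\<Sum>i<length ds. c i * ds ! i)"
    define G where "G = (\<Sum>i<length es. c (length ds + i) * es ! i)"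
    have F: "F \<in> ideal_pow J (Suc m)" unfolding F_def powJ ideal_gen_list by blast
    have "F + g * G \<in> ideal_pow K (Suc (Suc m))" using sum unfolding split F_def G_def .
    then obtain a b where a: "a \<in> ideal_pow J (Suc (Suc m))" and b: "b \<in> ideal_pow K (Suc m)"
      and FG: "F + g * G = a + g * b"
      unfolding K_def J_def by (rule ideal_pow_insert)
    \<comment> \<open>Here \<open>g * X = F - a\<close> lies in \<open>J ^ (m + 1)\<close>, and
      \<open>g\<close> is regular modulo that power, so \<open>X\<close> lies in it too. This has
      two uses: \<open>G = b - X\<close> falls into \<open>K ^ (m + 1)\<close>, and expanding
      \<open>X\<close> in \<open>ds\<close> rewrites \<open>a\<close> with coefficients
      \<open>c i - g * x i\<close>, to which independence of \<open>ds\<close> applies.\<close>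
    define X where "X = b - G"
    have gX: "g * X = F - a" using FG by (simp add: X_def algebra_simps)
    have a': "a \<in> ideal_pow J (Suc m)" using a ideal_pow_Suc_subset by blast
    then have "g * X \<in> ideal_pow J (Suc m)" unfolding gX using F by (intro ideal_diff) auto
    with fl idJ reg have X: "X \<in> ideal_pow J (Suc m)" by (rule regular_mod_pow)
    obtain x where x: "X = (\<Sum>i<length ds. x i * ds ! i)" using free_layer_sum[OF ds X] .
    have "(\<Sum>i<length ds. (c i - g * x i) * ds ! i) = F - g * X"
      by (simp add: F_def x left_diff_distrib sum_subtractf sum_distrib_left mult.assoc)
    also have "\<dots> = a" using gX by simp
    finally have "(\<Sum>i<length ds. (c i - g * x i) * ds ! i) \<in> ideal_pow J (Suc (Suc m))" using a by simp
    then have *: "c i - g * x i \<in> J" if "i < length ds" for i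
      using that by (rule free_layerD[OF ds, where c = "\<lambda>i. c i - g * x i"])
    have first: "c i \<in> K" if "i < length ds" for i
    proof -
      have "(c i - g * x i) + g * x i \<in> K"
        using *[OF that] JK g by (intro ideal_add ideal_mult_right idK) auto
      then show ?thesis by simp
    qed
    have "X \<in> ideal_pow K (Suc m)" using X ideal_pow_mono[OF JK] by blast
    then have "b - X \<in> ideal_pow K (Suc m)" using b by (intro ideal_diff) auto
    then have "G \<in> ideal_pow K (Suc m)" by (simp add: X_def)
    then have second: "c (length ds + i) \<in> K" if "i < length es" for i
      using that unfolding G_def by (rule free_layerD[OF es, where c = "\<lambda>i. c (length ds + i)"])
    show ?thesis
      using first[of i] second[of "i - length ds"] i by (cases "i < length ds") auto
  qed
  ultimately have "free_layer K (Suc m) ?bs" unfolding free_layer_def by blast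
  then show ?case ..
qed

lemma weakly_regular_free_layer:
  assumes "weakly_regular {} fs"
  shows "\<exists>es. free_layer (ideal_gen (set fs)) m es"
  using assms
proof (induction fs arbitrary: m)
  case Nil
  show ?case
  proof (cases m)
    case 0
    then show ?thesis using free_layer_0[OF is_ideal_gen] by blast
  next
    case (Suc n)
    \<comment> \<open>Above layer 0 all layers of the zero ideal vanish, so the empty list is a
      basis.\<close>
    have "ideal_pow {0::'a} (Suc n) = {0}"
      using ideal_mult_subset_left[of "{0::'a}"] ideal_zero[OF is_ideal_pow[of "{0::'a}" "Suc n"]] by auto
    then show ?thesis
      unfolding Suc by (intro exI[of _ "[]"]) (simp add: free_layer_def del: ideal_pow.simps)
  qed
next
  case (Cons g fs)
  then show ?case by (intro free_layer_Cons) auto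
qed

text \<open>All layers are free over \<open>R/J\<close>, so \<open>gs\<close> is regular on each of
  them and hence on the finite filtration of \<open>R/J ^ m\<close>. The outer induction shortens
  \<open>gs\<close>, the inner one raises the exponent for the head \<open>g\<close>.\<close>

lemma weakly_regular_pow:
  assumes fl: "\<And>m. \<exists>es. free_layer J m es" and J: "is_ideal J" and "weakly_regular J gs"
  shows "weakly_regular (ideal_pow J m) gs"
  using assms(3)
proof (induction gs arbitrary: m)
  case (Cons g gs)
  define L where "L = ideal_gen (J \<union> set gs)"
  have idL: "is_ideal L" by (simp add: L_def)
  have JL: "J \<subseteq> L" and KL: "ideal_gen (set gs) \<subseteq> L"
    using ideal_gen_superset[of "J \<union> set gs"] ideal_gen_mono[of "set gs" "J \<union> set gs"] by (auto simp: L_def)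
  have reg: "u \<in> L" if "g * u \<in> L" for u
    using Cons.prems that unfolding L_def by (rule weakly_regular_ConsD)
  have IH: "weakly_regular (ideal_pow J m) gs" for m
    using Cons.IH Cons.prems by (simp only: weakly_regular.simps)
  have Un: "x \<in> ideal_gen (ideal_pow J m \<union> set gs) \<longleftrightarrow>
      (\<exists>a\<in>ideal_pow J m. \<exists>b\<in>ideal_gen (set gs). x = a + b)" for x m
    by (simp add: ideal_gen_Un ideal_gen_ideal)
  have "u \<in> ideal_gen (ideal_pow J m \<union> set gs)"
    if "g * u \<in> ideal_gen (ideal_pow J m \<union> set gs)" for u
    using that
  proof (induction m arbitrary: u)
    case 0
    show ?case by (rule in_ideal_genI) simp
  next
    case (Suc m)
    from Suc.prems obtain a b where a: "a \<in> ideal_pow J (Suc m)" and b: "b \<in> ideal_gen (set gs)"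
      and gu: "g * u = a + b" unfolding Un by blast
    have am: "a \<in> ideal_pow J m" using a ideal_pow_Suc_subset by blast
    then have "g * u \<in> ideal_gen (ideal_pow J m \<union> set gs)" using gu b unfolding Un by blast
    then have "u \<in> ideal_gen (ideal_pow J m \<union> set gs)" by (rule Suc.IH)
    then obtain a' b' where a': "a' \<in> ideal_pow J m" and b': "b' \<in> ideal_gen (set gs)"
      and u: "u = a' + b'" unfolding Un by blast
    \<comment> \<open>The element \<open>c\<close> lies both in \<open>J ^ m\<close> and in the
      ideal of the tail. The tail is regular modulo \<open>J ^ m\<close>, so \<open>c\<close> lies
      in the product, hence in \<open>L J ^ m\<close>. Then \<open>g * a' = c + a\<close> does as
      well, and \<open>g\<close> cancels in the free \<open>R/L\<close>-module
      \<open>J ^ m / L J ^ m\<close>.\<close>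
    define c where "c = b - g * b'"
    have c: "c = g * a' - a" using gu u by (simp add: c_def algebra_simps)
    have "c \<in> ideal_gen (set gs)" unfolding c_def using b b' by (intro ideal_diff ideal_mult_left) auto
    moreover have "c \<in> ideal_pow J m" unfolding c using am a' by (intro ideal_diff ideal_mult_left) auto
    ultimately have "c \<in> ideal_mult (ideal_pow J m) (ideal_gen (set gs))"
      using weakly_regular_Int[OF is_ideal_pow IH] by blast
    also have "\<dots> \<subseteq> ideal_mult L (ideal_pow J m)"
    proof (rule ideal_mult_subset[OF is_ideal_mult])
      fix x y assume "x \<in> ideal_pow J m" "y \<in> ideal_gen (set gs)"
      then have "y * x \<in> ideal_mult L (ideal_pow J m)" using KL by (auto intro: ideal_multI)
      then show "x * y \<in> ideal_mult L (ideal_pow J m)" by (simp add: mult.commute)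
    qed
    finally have "c \<in> ideal_mult L (ideal_pow J m)" .
    moreover have "a \<in> ideal_mult L (ideal_pow J m)"
      using a ideal_mult_mono[OF JL order_refl] by auto
    ultimately have "c + a \<in> ideal_mult L (ideal_pow J m)" by (intro ideal_add) auto
    then have ga': "g * a' \<in> ideal_mult L (ideal_pow J m)" by (simp add: c)
    obtain es where es: "free_layer J m es" using fl by blast
    have "a' \<in> ideal_mult L (ideal_pow J m)"
      by (rule free_layer_cancel[OF es J idL JL _ a' ga']) (rule reg)
    also have "\<dots> \<subseteq> ideal_gen (ideal_pow J (Suc m) \<union> set gs)"
    proof (rule ideal_mult_subset)
      fix x y assume "x \<in> L" and y: "y \<in> ideal_pow J m"
      then obtain p q where "x = p + q" "p \<in> J" "q \<in> ideal_gen (set gs)"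
        by (auto simp: L_def ideal_gen_Un ideal_gen_ideal[OF J])
      then show "x * y \<in> ideal_gen (ideal_pow J (Suc m) \<union> set gs)"
        using y unfolding Un
        by (intro bexI[of _ "p * y"] bexI[of _ "q * y"])
          (auto simp: distrib_right intro: ideal_multI ideal_mult_right)
    qed simp
    finally have "a' \<in> ideal_gen (ideal_pow J (Suc m) \<union> set gs)" .
    moreover have "b' \<in> ideal_gen (ideal_pow J (Suc m) \<union> set gs)"
      using b' ideal_gen_mono[of "set gs" "ideal_pow J (Suc m) \<union> set gs"] by blast
    ultimately show ?case unfolding u by (intro ideal_add) auto
  qed
  then show ?case using IH unfolding weakly_regular.simps by blast
qed simp

text \<open>Expand \<open>u\<close> in a basis of the layer \<open>K ^ j\<close>. By induction its
  coefficients can be taken in \<open>I\<close>; independence puts them in \<open>K\<close>, because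
  \<open>u\<close> lies in the next power. So they lie in \<open>I K\<close> by
  \<open>weakly_regular_Int\<close>, which raises the exponent by one.\<close>

lemma weakly_regular_Int_pow:
  fixes gs :: "'a::comm_ring_1 list"
  assumes I: "is_ideal I" "weakly_regular I gs" and gs: "weakly_regular {} gs"
  defines "K \<equiv> ideal_gen (set gs)"
  shows "I \<inter> ideal_pow K j \<subseteq> ideal_mult I (ideal_pow K j)"
proof (induction j)
  case 0
  show ?case using ideal_multI[of _ I 1 UNIV] by auto
next
  case (Suc j)
  show ?case
  proof
    fix u assume u: "u \<in> I \<inter> ideal_pow K (Suc j)"
    obtain es where es: "free_layer K j es" using weakly_regular_free_layer[OF gs] unfolding K_def by blast
    have idK: "is_ideal K" by (simp add: K_def)
    have "u \<in> ideal_mult I (ideal_pow K j)" using u Suc ideal_pow_Suc_subset by blast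
    then obtain c where c: "\<forall>i<length es. c i \<in> I" and u_eq: "u = (\<Sum>i<length es. c i * es ! i)"
      using es by (auto simp: free_layer_def ideal_mult_list[OF I(1)])
    have "c i \<in> K" if "i < length es" for i
      using es u that unfolding free_layer_def u_eq by blast
    then have "c i \<in> ideal_mult I K" if "i < length es" for i
      using c that weakly_regular_Int[OF I] unfolding K_def by blast
    then have "u \<in> ideal_mult (ideal_mult I K) (ideal_pow K j)"
      unfolding u_eq by (intro free_layer_sum_in[OF es]) auto
    then show "u \<in> ideal_mult I (ideal_pow K (Suc j))"
      using ideal_mult_assoc_subset by auto
  qed
qed

lemma weakly_regular_pow_Int_pow:
  fixes gs fs :: "'a::comm_ring_1 list"
  assumes "weakly_regular {} (gs @ fs)" "weakly_regular {} gs"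
  defines "J \<equiv> ideal_gen (set fs)" and "K \<equiv> ideal_gen (set gs)"
  shows "ideal_pow J m \<inter> ideal_pow K m \<subseteq> ideal_pow (J \<inter> K) m"
proof -
  have fs: "weakly_regular {} fs" and gs: "weakly_regular J gs"
    using assms(1) by (auto simp: weakly_regular_append J_def)
  have "weakly_regular (ideal_pow J m) gs"
    using weakly_regular_free_layer[OF fs] gs unfolding J_def
    by (intro weakly_regular_pow) auto
  then have "ideal_pow J m \<inter> ideal_pow K m \<subseteq> ideal_mult (ideal_pow J m) (ideal_pow K m)"
    unfolding K_def by (intro weakly_regular_Int_pow assms(2)) auto
  also have "\<dots> \<subseteq> ideal_pow (J \<inter> K) m"
    by (intro ideal_pow_mult_subset) (auto simp: J_def K_def intro: ideal_mult_left ideal_mult_right)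
  finally show ?thesis .
qed

subsection \<open>The Koszul complex\<close>

text \<open>The Koszul complex on \<open>hs\<close>: a word \<open>w\<close> of length \<open>length hs\<close> stands for the basis vector of
  the exterior algebra which is the product of the \<open>e\<^sub>i\<close> with \<open>w ! i\<close> true; a chain is the function of
  its coefficients. Values at words of other lengths are junk.\<close>
fun koszul_d :: "'a::comm_ring_1 list \<Rightarrow> (bool list \<Rightarrow> 'a) \<Rightarrow> bool list \<Rightarrow> 'a" where
  "koszul_d (h # hs) z (False # w) = koszul_d hs (\<lambda>v. z (False # v)) w + h * z (True # w)"
| "koszul_d (h # hs) z (True # w) = - koszul_d hs (\<lambda>v. z (True # v)) w"
| "koszul_d (h # hs) z [] = 0"
| "koszul_d [] z w = 0"

text \<open>Left exterior multiplication by the sum of the \<open>cs ! i * e\<^sub>i\<close>.\<close>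
fun koszul_wedge :: "'a::comm_ring_1 list \<Rightarrow> (bool list \<Rightarrow> 'a) \<Rightarrow> bool list \<Rightarrow> 'a" where
  "koszul_wedge (c # cs) z (True # w) = c * z (False # w) - koszul_wedge cs (\<lambda>v. z (True # v)) w"
| "koszul_wedge (c # cs) z (False # w) = koszul_wedge cs (\<lambda>v. z (False # v)) w"
| "koszul_wedge (c # cs) z [] = 0"
| "koszul_wedge [] z w = 0"

section \<open>Linearity of the Koszul operators and the homotopy formula\<close>

lemma koszul_d_add: "koszul_d hs (\<lambda>w. a w + b w) w = koszul_d hs a w + koszul_d hs b w"
  by (induction hs a w arbitrary: b rule: koszul_d.induct)
    (simp_all add: distrib_left add.assoc add.left_commute)

lemma koszul_d_mult: "koszul_d hs (\<lambda>w. r * a w) w = r * koszul_d hs a w"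
  by (induction hs a w rule: koszul_d.induct) (simp_all add: algebra_simps)

lemma koszul_d_uminus: "koszul_d hs (\<lambda>w. - a w) w = - koszul_d hs a w"
  using koszul_d_mult[of hs "-1" a w] by simp

lemma koszul_d_zero: "koszul_d hs (\<lambda>w. 0) w = 0"
  using koszul_d_mult[of hs 0 "\<lambda>_. 0" w] by simp

lemma koszul_wedge_add:
  "koszul_wedge cs (\<lambda>w. a w + b w) w = koszul_wedge cs a w + koszul_wedge cs b w"
  by (induction cs a w arbitrary: b rule: koszul_wedge.induct) (simp_all add: distrib_left)

lemma koszul_wedge_mult: "koszul_wedge cs (\<lambda>w. r * a w) w = r * koszul_wedge cs a w"
  by (induction cs a w rule: koszul_wedge.induct) (simp_all add: algebra_simps)

lemma koszul_wedge_uminus: "koszul_wedge cs (\<lambda>w. - a w) w = - koszul_wedge cs a w"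
  using koszul_wedge_mult[of cs "-1" a w] by simp

lemma koszul_d_square: "koszul_d hs (koszul_d hs z) w = 0"
proof (induction hs arbitrary: z w)
  case (Cons h hs)
  show ?case
  proof (cases w)
    case (Cons b v)
    show ?thesis
      using Cons Cons.IH
      by (cases b) (simp_all add: koszul_d_add koszul_d_mult koszul_d_uminus)
  qed simp
qed simp

text \<open>The differential is contraction with \<open>hs\<close>, an antiderivation of the
  exterior algebra. Contraction and left multiplication therefore anticommute up to the pairing of
  \<open>cs\<close> with \<open>hs\<close>.\<close>

lemma koszul_homotopy:
  assumes "length w = length hs" "length cs = length hs"
  shows "koszul_d hs (koszul_wedge cs z) w + koszul_wedge cs (koszul_d hs z) w =
    (\<Sum>i<length hs. cs ! i * hs ! i) * z w"
  using assms
proof (induction hs arbitrary: z w cs)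
  case (Cons h hs)
  obtain b v where w: "w = b # v" using Cons.prems by (cases w) auto
  obtain c ds where cs: "cs = c # ds" using Cons.prems by (cases cs) auto
  have IH: "koszul_d hs (koszul_wedge ds y) v + koszul_wedge ds (koszul_d hs y) v =
    (\<Sum>i<length hs. ds ! i * hs ! i) * y v" for y
    using Cons.prems w cs by (intro Cons.IH) auto
  have minus: "koszul_d hs (\<lambda>w. a w - b w) w = koszul_d hs a w - koszul_d hs b w" for a b w
    using koszul_d_add[of hs a "\<lambda>w. - b w" w] koszul_d_uminus[of hs b w] by simp
  have sum: "(\<Sum>i<length (h # hs). cs ! i * (h # hs) ! i) = c * h + (\<Sum>i<length hs. ds ! i * hs ! i)"
    by (simp add: cs sum.lessThan_Suc_shift del: sum.lessThan_Suc)
  show ?case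
  proof (cases b)
    case True
    have d: "koszul_d (h # hs) (koszul_wedge cs z) w =
        koszul_d hs (koszul_wedge ds (\<lambda>v. z (True # v))) v - c * koszul_d hs (\<lambda>v. z (False # v)) v"
      using True by (simp add: w cs minus koszul_d_mult)
    have wedge: "koszul_wedge cs (koszul_d (h # hs) z) w =
        c * (koszul_d hs (\<lambda>v. z (False # v)) v + h * z (True # v)) +
        koszul_wedge ds (koszul_d hs (\<lambda>v. z (True # v))) v"
      using True by (simp add: w cs koszul_wedge_uminus)
    show ?thesis
      unfolding d wedge sum using IH[of "\<lambda>v. z (True # v)"] True by (simp add: w algebra_simps)
  next
    case False
    have d: "koszul_d (h # hs) (koszul_wedge cs z) w =
        koszul_d hs (koszul_wedge ds (\<lambda>v. z (False # v))) v +
        h * (c * z (False # v) - koszul_wedge ds (\<lambda>v. z (True # v)) v)"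
      using False by (simp add: w cs)
    have wedge: "koszul_wedge cs (koszul_d (h # hs) z) w =
        koszul_wedge ds (koszul_d hs (\<lambda>v. z (False # v))) v +
        h * koszul_wedge ds (\<lambda>v. z (True # v)) v"
      using False by (simp add: w cs koszul_wedge_add koszul_wedge_mult)
    show ?thesis
      unfolding d wedge sum using IH[of "\<lambda>v. z (False # v)"] False by (simp add: w algebra_simps)
  qed
qed simp

lemma koszul_d_in_ideal:
  assumes "is_ideal I" "\<And>w. length w = length hs \<Longrightarrow> z w \<in> I" "length w = length hs"
  shows "koszul_d hs z w \<in> I"
  using assms(2,3)
proof (induction hs arbitrary: z w)
  case Nil
  then show ?case using assms(1) by (simp add: ideal_zero)
next
  case (Cons h hs)
  obtain b v where w: "w = b # v" using Cons.prems by (cases w) auto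
  have "koszul_d hs (\<lambda>v. z (b # v)) v \<in> I"
    using Cons.prems w by (intro Cons.IH) auto
  then show ?case using Cons.prems(1)[of "True # v"] Cons.prems(2) assms(1)
    by (cases b) (auto simp: w intro: ideal_closed)
qed

lemma koszul_wedge_in_ideal:
  assumes "is_ideal I" "\<And>w. length w = length cs \<Longrightarrow> z w \<in> I" "length w = length cs"
  shows "koszul_wedge cs z w \<in> I"
  using assms(2,3)
proof (induction cs arbitrary: z w)
  case Nil
  then show ?case using assms(1) by (simp add: ideal_zero)
next
  case (Cons c cs)
  obtain b v where w: "w = b # v" using Cons.prems by (cases w) auto
  have "koszul_wedge cs (\<lambda>v. z (b # v)) v \<in> I"
    using Cons.prems w by (intro Cons.IH) auto
  then show ?case using Cons.prems(1)[of "False # v"] Cons.prems(2) assms(1)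
    by (cases b) (auto simp: w intro: ideal_closed)
qed

lemma koszul_d_cong:
  assumes "\<And>w. length w = length hs \<Longrightarrow> y w = z w" "length w = length hs"
  shows "koszul_d hs y w = koszul_d hs z w"
proof -
  have "koszul_d hs (\<lambda>w. y w + - z w) w \<in> {0}"
    using assms by (intro koszul_d_in_ideal) auto
  then have "koszul_d hs y w + - koszul_d hs z w = 0"
    by (simp only: koszul_d_add koszul_d_uminus singleton_iff)
  then show ?thesis by simp
qed

section \<open>Degrees of chains and depth sensitivity\<close>

abbreviation word_degree :: "bool list \<Rightarrow> nat" where
  "word_degree w \<equiv> count_list w True"

text \<open>Chains need not be homogeneous. A lower bound for the degrees that occur is enough,
  since the depth argument only pushes this bound up.\<close>

definition koszul_supp :: "nat \<Rightarrow> nat \<Rightarrow> (bool list \<Rightarrow> 'a::comm_ring_1) \<Rightarrow> bool" where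
  "koszul_supp N q z \<longleftrightarrow> (\<forall>w. length w = N \<longrightarrow> word_degree w < q \<longrightarrow> z w = 0)"

lemma koszul_wedge_supp:
  assumes "koszul_supp (length cs) q z"
  shows "koszul_supp (length cs) (Suc q) (koszul_wedge cs z)"
  using assms
proof (induction cs arbitrary: q z)
  case Nil
  then show ?case by (simp add: koszul_supp_def)
next
  case (Cons c cs)
  have "koszul_supp (length cs) q (\<lambda>v. z (False # v))"
    using Cons.prems by (auto simp: koszul_supp_def)
  then have F: "koszul_supp (length cs) (Suc q) (koszul_wedge cs (\<lambda>v. z (False # v)))"
    by (rule Cons.IH)
  have "koszul_supp (length cs) (q - 1) (\<lambda>v. z (True # v))"
    using Cons.prems by (auto simp: koszul_supp_def)
  \<comment> \<open>For \<open>q = 0\<close> the subtraction stops at 0, which is harmless: a word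
    starting with \<open>True\<close> has degree at least 1, so nothing is claimed about it.\<close>
  then have T: "koszul_supp (length cs) (Suc (q - 1)) (koszul_wedge cs (\<lambda>v. z (True # v)))"
    by (rule Cons.IH)
  show ?case
    unfolding koszul_supp_def
  proof (intro allI impI)
    fix w :: "bool list" assume w: "length w = length (c # cs)" "word_degree w < Suc q"
    obtain b v where "w = b # v" using w by (cases w) auto
    then show "koszul_wedge (c # cs) z w = 0"
      using w F T Cons.prems by (cases b) (auto simp: koszul_supp_def)
  qed
qed

text \<open>Multiplication by \<open>y\<close> is nullhomotopic on the Koszul complex. Hence, if \<open>y\<close> is a
  nonzerodivisor on \<open>R/I\<close>, the connecting map \<open>H\<^sub>q\<^sub>+\<^sub>1(R/(I + y)) \<rightarrow> H\<^sub>q(R/I)\<close> is onto.\<close>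
lemma koszul_step:
  assumes I: "is_ideal I" and reg: "\<And>u. y * u \<in> I \<Longrightarrow> u \<in> I" and y: "y \<in> ideal_gen (set hs)"
    and supp: "koszul_supp (length hs) q z"
    and cycle: "\<And>w. length w = length hs \<Longrightarrow> koszul_d hs z w \<in> I"
    and no_bd: "\<nexists>v. \<forall>w. length w = length hs \<longrightarrow> z w - koszul_d hs v w \<in> I"
  defines "I' \<equiv> ideal_gen (insert y I)"
  shows "\<exists>z'. koszul_supp (length hs) (Suc q) z' \<and>
    (\<forall>w. length w = length hs \<longrightarrow> koszul_d hs z' w \<in> I') \<and>
    (\<nexists>v. \<forall>w. length w = length hs \<longrightarrow> z' w - koszul_d hs v w \<in> I')"
proof -
  have I': "x \<in> I' \<longleftrightarrow> (\<exists>a\<in>I. \<exists>r. x = a + r * y)" for x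
    unfolding I'_def ideal_gen_insert ideal_gen_ideal[OF I] ..
  obtain c where c: "y = (\<Sum>i<length hs. c i * hs ! i)" using y ideal_gen_list by blast
  define cs where "cs = map c [0..<length hs]"
  have len: "length cs = length hs" by (simp add: cs_def)
  have y_eq: "y = (\<Sum>i<length hs. cs ! i * hs ! i)" by (simp add: c cs_def)
  have hom: "koszul_d hs (koszul_wedge cs z) w = y * z w - koszul_wedge cs (koszul_d hs z) w"
    if "length w = length hs" for w
    using koszul_homotopy[OF that len, of z] unfolding y_eq[symmetric] by (simp add: eq_diff_eq)
  have wI: "koszul_wedge cs (koszul_d hs z) w \<in> I" if "length w = length hs" for w
    using that cycle len by (intro koszul_wedge_in_ideal I) auto
  show ?thesis
  proof (intro exI[of _ "koszul_wedge cs z"] conjI allI impI notI)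
    show "koszul_supp (length hs) (Suc q) (koszul_wedge cs z)"
      using koszul_wedge_supp[of cs q z] supp len by simp
  next
    fix w :: "bool list" assume w: "length w = length hs"
    have "koszul_d hs (koszul_wedge cs z) w = - koszul_wedge cs (koszul_d hs z) w + z w * y"
      using hom[OF w] by simp
    then show "koszul_d hs (koszul_wedge cs z) w \<in> I'"
      unfolding I' using ideal_uminus[OF I wI[OF w]] by blast
  next
    assume "\<exists>v. \<forall>w. length w = length hs \<longrightarrow> koszul_wedge cs z w - koszul_d hs v w \<in> I'"
    then obtain v where "\<forall>w. length w = length hs \<longrightarrow>
        (\<exists>a r. a \<in> I \<and> koszul_wedge cs z w - koszul_d hs v w = a + r * y)"
      unfolding I' by blast
    then obtain a u where au: "\<And>w. length w = length hs \<Longrightarrow> a w \<in> I"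
        "\<And>w. length w = length hs \<Longrightarrow> koszul_wedge cs z w - koszul_d hs v w = a w + u w * y"
      by metis
    \<comment> \<open>Apply the differential to \<open>koszul_wedge cs z = d v + a + y * u\<close>.
      It kills \<open>d v\<close>, and by the homotopy the left side becomes \<open>y * z\<close>
      modulo \<open>I\<close>. Cancelling \<open>y\<close> exhibits \<open>z\<close> as the boundary
      of \<open>u\<close> modulo \<open>I\<close>.\<close>
    have "z w - koszul_d hs u w \<in> I" if w: "length w = length hs" for w
    proof (rule reg)
      have "koszul_wedge cs z w = koszul_d hs v w + (a w + y * u w)" if "length w = length hs" for w
        using au(2)[OF that] by (simp add: algebra_simps)
      then have "koszul_d hs (koszul_wedge cs z) w =
          koszul_d hs (\<lambda>w. koszul_d hs v w + (a w + y * u w)) w"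
        using w by (intro koszul_d_cong) auto
      also have "\<dots> = koszul_d hs a w + y * koszul_d hs u w"
        by (simp add: koszul_d_add koszul_d_square koszul_d_mult)
      finally have "y * (z w - koszul_d hs u w) = koszul_d hs a w + koszul_wedge cs (koszul_d hs z) w"
        using hom[OF w] by (simp add: algebra_simps)
      moreover have "koszul_d hs a w \<in> I" using au(1) w by (intro koszul_d_in_ideal I) auto
      ultimately show "y * (z w - koszul_d hs u w) \<in> I" using wI[OF w] ideal_add[OF I] by simp
    qed
    then show False using no_bd by blast
  qed
qed

lemma word_degree_le_length: "word_degree w \<le> length w"
  by (rule count_le_length)

text \<open>Each element of \<open>ys\<close> trades a nonbounding cycle for one whose lowest degree
  is larger by one, over a smaller quotient. There are no chains above degree
  \<open>length hs\<close>, and the zero chain bounds, so the trade cannot happen too often.\<close>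

lemma koszul_depth:
  assumes ys: "weakly_regular {} ys" "set ys \<subseteq> ideal_gen (set hs)"
    and supp: "koszul_supp (length hs) q z"
    and cycle: "\<And>w. length w = length hs \<Longrightarrow> koszul_d hs z w = 0"
    and no_bd: "\<nexists>v. \<forall>w. length w = length hs \<longrightarrow> z w = koszul_d hs v w"
  shows "q + length ys \<le> length hs"
proof -
  have "\<exists>z'. koszul_supp (length hs) (q + length ys) z' \<and>
    (\<forall>w. length w = length hs \<longrightarrow> koszul_d hs z' w \<in> ideal_gen (set ys)) \<and>
    (\<nexists>v. \<forall>w. length w = length hs \<longrightarrow> z' w - koszul_d hs v w \<in> ideal_gen (set ys))"
    using ys
  proof (induction ys)
    case Nil
    then show ?case using supp cycle no_bd by (intro exI[of _ z]) auto
  next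
    case (Cons y ys)
    have "weakly_regular {} ys" "set ys \<subseteq> ideal_gen (set hs)" using Cons.prems by auto
    from Cons.IH[OF this] obtain z' where z': "koszul_supp (length hs) (q + length ys) z'"
      "\<And>w. length w = length hs \<Longrightarrow> koszul_d hs z' w \<in> ideal_gen (set ys)"
      "\<nexists>v. \<forall>w. length w = length hs \<longrightarrow> z' w - koszul_d hs v w \<in> ideal_gen (set ys)"
      by blast
    have reg: "u \<in> ideal_gen (set ys)" if "y * u \<in> ideal_gen (set ys)" for u
      using weakly_regular_ConsD[OF Cons.prems(1), of u] that by simp
    have y: "y \<in> ideal_gen (set hs)" using Cons.prems by simp
    have eq: "ideal_gen (insert y (ideal_gen (set ys))) = ideal_gen (set (y # ys))"
      using ideal_gen_gen_Un[of "set ys" "{y}"] by simp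
    show ?case
      using koszul_step[OF is_ideal_gen reg y z'] unfolding eq by simp
  qed
  then obtain z' where z': "koszul_supp (length hs) (q + length ys) z'"
    and no_bd': "\<nexists>v. \<forall>w. length w = length hs \<longrightarrow> z' w - koszul_d hs v w \<in> ideal_gen (set ys)"
    by blast
  show ?thesis
  proof (rule ccontr)
    assume less: "\<not> q + length ys \<le> length hs"
    have "z' w - koszul_d hs (\<lambda>_. 0) w \<in> ideal_gen (set ys)" if "length w = length hs" for w
    proof -
      have "z' w = 0"
        using z' that less word_degree_le_length[of w] by (auto simp: koszul_supp_def)
      then show ?thesis by (simp add: koszul_d_zero ideal_zero)
    qed
    then show False using no_bd' by blast
  qed
qed

section \<open>Vanishing of all homology in positive degrees\<close>

definition koszul_acyclic :: "'a::comm_ring_1 list \<Rightarrow> bool" where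
  "koszul_acyclic hs \<longleftrightarrow> (\<forall>z. koszul_supp (length hs) 1 z \<longrightarrow>
     (\<forall>w. length w = length hs \<longrightarrow> koszul_d hs z w = 0) \<longrightarrow>
     (\<exists>v. \<forall>w. length w = length hs \<longrightarrow> z w = koszul_d hs v w))"

lemma koszul_d_bottom:
  "word_degree w = 0 \<Longrightarrow> length w = length hs \<Longrightarrow> koszul_d hs v w \<in> ideal_gen (set hs)"
proof (induction hs arbitrary: v w)
  case Nil
  then show ?case by simp
next
  case (Cons h hs)
  then obtain u where w: "w = False # u" by (cases w) (auto split: if_splits)
  have "koszul_d hs (\<lambda>u. v (False # u)) u \<in> ideal_gen (set hs)"
    using Cons w by auto
  moreover have "koszul_d (h # hs) v w = koszul_d hs (\<lambda>u. v (False # u)) u + v (True # u) * h"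
    by (simp add: w mult.commute)
  ultimately show ?case unfolding list.set ideal_gen_insert by blast
qed

lemma koszul_d_degree_zero: "koszul_d hs (\<lambda>w. if word_degree w = 0 then c else 0) w = 0"
proof (induction hs arbitrary: w)
  case (Cons h hs)
  show ?case
  proof (cases w)
    case (Cons b u)
    then show ?thesis using Cons.IH by (cases b) (simp_all add: koszul_d_zero)
  qed simp
qed simp

text \<open>The degree-0 homology is \<open>R\<close> modulo the ideal of \<open>hs\<close>, and the
  class of 1 is nonzero for a proper ideal. So \<open>koszul_depth\<close> applies with
  \<open>q = 0\<close>.\<close>

lemma koszul_depth_zero:
  assumes "weakly_regular {} ys" "set ys \<subseteq> ideal_gen (set hs)" "1 \<notin> ideal_gen (set hs)"
  shows "length ys \<le> length hs"
proof -
  define z :: "bool list \<Rightarrow> 'a" where "z w = (if word_degree w = 0 then 1 else 0)" for w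
  have cycle: "koszul_d hs z w = 0" for w
    unfolding z_def[abs_def] by (rule koszul_d_degree_zero)
  have "\<nexists>v. \<forall>w. length w = length hs \<longrightarrow> z w = koszul_d hs v w"
  proof
    assume "\<exists>v. \<forall>w. length w = length hs \<longrightarrow> z w = koszul_d hs v w"
    then obtain v where v: "\<And>w. length w = length hs \<Longrightarrow> z w = koszul_d hs v w" by blast
    have deg: "word_degree (replicate (length hs) False) = 0" by (simp add: count_list_0_iff)
    have "1 = koszul_d hs v (replicate (length hs) False)"
      using v[of "replicate (length hs) False"] deg by (simp add: z_def)
    then show False using koszul_d_bottom[OF deg, of hs v] assms(3) by simp
  qed
  from koszul_depth[OF assms(1,2) _ cycle this, of 0] show ?thesis by (simp add: koszul_supp_def)
qed

text \<open>A nonbounding cycle in degrees at least 1 would give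
  \<open>1 + length ys \<le> length hs\<close>.\<close>

lemma koszul_acyclic_depth:
  assumes "weakly_regular {} ys" "set ys \<subseteq> ideal_gen (set hs)" "length hs \<le> length ys"
  shows "koszul_acyclic hs"
  unfolding koszul_acyclic_def
proof (intro allI impI)
  fix z :: "bool list \<Rightarrow> 'a"
  assume "koszul_supp (length hs) 1 z" and "\<forall>w. length w = length hs \<longrightarrow> koszul_d hs z w = 0"
  then show "\<exists>v. \<forall>w. length w = length hs \<longrightarrow> z w = koszul_d hs v w"
    using koszul_depth[OF assms(1,2), of 1 z] assms(3) by fastforce
qed

text \<open>The coefficients in an expansion of \<open>x\<close> in \<open>hs\<close> form a chain
  of degree 1.\<close>

lemma koszul_d_top_of_combination:
  assumes "x \<in> ideal_gen (set hs)"
  shows "\<exists>v. koszul_supp (length hs) 1 v \<and> (\<forall>w. length w = length hs \<longrightarrow>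
    koszul_d hs v w = (if word_degree w = 0 then x else 0))"
  using assms
proof (induction hs arbitrary: x)
  case Nil
  then show ?case by (intro exI[of _ "\<lambda>_. 0"]) (auto simp: koszul_supp_def)
next
  case (Cons h hs)
  obtain a r where a: "a \<in> ideal_gen (set hs)" and x: "x = a + r * h"
    using Cons.prems by (auto simp: ideal_gen_insert)
  obtain v where v: "koszul_supp (length hs) 1 v"
    "\<And>w. length w = length hs \<Longrightarrow> koszul_d hs v w = (if word_degree w = 0 then a else 0)"
    using Cons.IH[OF a] by blast
  define v' where "v' w = (case w of [] \<Rightarrow> 0 | b # u \<Rightarrow>
    if b then (if word_degree u = 0 then r else 0) else v u)" for w
  show ?case
  proof (intro exI[of _ v'] conjI allI impI)
    show "koszul_supp (length (h # hs)) 1 v'"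
      using v(1) by (auto simp: koszul_supp_def v'_def split: list.splits)
    fix w :: "bool list" assume w: "length w = length (h # hs)"
    then obtain b u where "w = b # u" by (cases w) auto
    then show "koszul_d (h # hs) v' w = (if word_degree w = 0 then x else 0)"
      using w v(2)[of u] koszul_d_degree_zero[of hs r u] by (cases b) (simp_all add: v'_def x mult.commute)
  qed
qed

text \<open>Writing \<open>h * u = d v\<close> over \<open>hs\<close> gives the cycle
  \<open>u e_h - v\<close> over \<open>h # hs\<close>. It bounds, and comparing coefficients at
  \<open>e_h\<close> shows that \<open>u\<close> is, up to sign, a degree-0 boundary over
  \<open>hs\<close>.\<close>

lemma koszul_acyclic_regular:
  assumes ac: "koszul_acyclic (h # hs)" and hu: "h * u \<in> ideal_gen (set hs)"
  shows "u \<in> ideal_gen (set hs)"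
proof -
  obtain v where v: "koszul_supp (length hs) 1 v"
    "\<And>w. length w = length hs \<Longrightarrow> koszul_d hs v w = (if word_degree w = 0 then h * u else 0)"
    using koszul_d_top_of_combination[OF hu] by blast
  define z where "z w = (case w of [] \<Rightarrow> 0 | b # w \<Rightarrow>
    if b then (if word_degree w = 0 then u else 0) else - v w)" for w
  have "koszul_supp (length (h # hs)) 1 z"
    using v(1) by (auto simp: koszul_supp_def z_def split: list.splits)
  moreover have "koszul_d (h # hs) z w = 0" if w: "length w = length (h # hs)" for w
  proof -
    obtain b y where "w = b # y" using w by (cases w) auto
    then show ?thesis
      using w v(2)[of y] koszul_d_degree_zero[of hs u y] by (cases b) (simp_all add: z_def koszul_d_uminus)
  qed
  ultimately obtain y where y: "\<And>w. length w = length (h # hs) \<Longrightarrow> z w = koszul_d (h # hs) y w"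
    using ac unfolding koszul_acyclic_def by blast
  let ?w = "replicate (length hs) False"
  have deg: "word_degree ?w = 0" by (simp add: count_list_0_iff)
  have "u = - koszul_d hs (\<lambda>w. y (True # w)) ?w"
    using y[of "True # ?w"] deg by (simp add: z_def)
  then show ?thesis using koszul_d_bottom[OF deg, of hs] by (simp add: ideal_uminus)
qed

text \<open>The differential lowers the degree by exactly one. This allows low-degree components of
  a bounding chain to be discarded.\<close>

lemma koszul_d_restrict:
  assumes "length w = length hs"
  shows "koszul_d hs (\<lambda>w. if word_degree w < Suc k then 0 else z w) w =
    (if word_degree w < k then 0 else koszul_d hs z w)"
  using assms
proof (induction hs arbitrary: k z w)
  case (Cons h hs)
  obtain b u where w: "w = b # u" and u: "length u = length hs" using Cons.prems by (cases w) auto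
  show ?case
  proof (cases b)
    case True
    show ?thesis
    proof (cases k)
      case 0
      then have "koszul_d (h # hs) (\<lambda>w. if word_degree w < Suc k then 0 else z w) w =
        - koszul_d hs (\<lambda>v. z (True # v)) u" using True w by simp
      then show ?thesis using True w 0 by simp
    next
      case (Suc j)
      then show ?thesis using True w Cons.IH[OF u, of j "\<lambda>v. z (True # v)"] by simp
    qed
  next
    case False
    then show ?thesis using w Cons.IH[OF u, of k "\<lambda>v. z (False # v)"] by simp
  qed
qed simp

text \<open>One step of the Nakayama argument: \<open>H\<^sub>q(hs) = h H\<^sub>q(hs)\<close> for \<open>q \<ge> 1\<close>.\<close>
lemma koszul_acyclic_ConsD:
  assumes ac: "koszul_acyclic (h # hs)" and supp: "koszul_supp (length hs) 1 z"
    and cycle: "\<And>w. length w = length hs \<Longrightarrow> koszul_d hs z w = 0"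
  obtains v z' where "koszul_supp (length hs) 1 z'"
    "\<And>w. length w = length hs \<Longrightarrow> koszul_d hs z' w = 0"
    "\<And>w. length w = length hs \<Longrightarrow> z w = koszul_d hs v w + h * z' w"
proof -
  \<comment> \<open>The cycle \<open>z\<close> is viewed over \<open>h # hs\<close>. A chain
    \<open>x\<close> bounding it splits according to whether \<open>e_h\<close> occurs; the part
    with \<open>e_h\<close> is again a cycle over \<open>hs\<close> and becomes
    \<open>z'\<close>.\<close>
  define y where "y w = (case w of [] \<Rightarrow> 0 | b # w \<Rightarrow> if b then 0 else z w)" for w
  have "koszul_supp (length (h # hs)) 1 y"
    using supp by (auto simp: koszul_supp_def y_def split: list.splits)
  moreover have "koszul_d (h # hs) y w = 0" if w: "length w = length (h # hs)" for w
  proof -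
    obtain b u where "w = b # u" using w by (cases w) auto
    then show ?thesis
      using w cycle[of u] by (cases b) (simp_all add: y_def koszul_d_zero)
  qed
  ultimately obtain x where x: "\<And>w. length w = length (h # hs) \<Longrightarrow> y w = koszul_d (h # hs) x w"
    using ac unfolding koszul_acyclic_def by blast
  have xF: "z w = koszul_d hs (\<lambda>u. x (False # u)) w + h * x (True # w)"
    and xT: "koszul_d hs (\<lambda>u. x (True # u)) w = 0" if "length w = length hs" for w
    using x[of "False # w"] x[of "True # w"] that by (simp_all add: y_def)
  \<comment> \<open>Both parts of \<open>x\<close> are cut so that \<open>z'\<close> lives in
    degrees at least 1. Discarding degrees below 2 from \<open>v\<close> changes its boundary only
    in degree 0, where \<open>z\<close> and \<open>z'\<close> vanish, so the equation still holds
    there.\<close>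
  define z' where "z' = (\<lambda>w. if word_degree w < Suc 0 then 0 else x (True # w))"
  define v where "v = (\<lambda>w. if word_degree w < Suc 1 then 0 else x (False # w))"
  show thesis
  proof (rule that[of z' v])
    show "koszul_supp (length hs) 1 z'" by (simp add: koszul_supp_def z'_def)
    fix w :: "bool list" assume w: "length w = length hs"
    show "koszul_d hs z' w = 0"
      unfolding z'_def koszul_d_restrict[OF w] by (simp add: xT[OF w])
    show "z w = koszul_d hs v w + h * z' w"
      unfolding v_def koszul_d_restrict[OF w] using xF[OF w] supp w
      by (cases "word_degree w = 0") (simp_all add: z'_def koszul_supp_def)
  qed
qed

subsection \<open>Graded Nakayama and powers of variables\<close>

lemma poly_mapping_sum_single:
  "f = (\<Sum>\<mu>\<in>Poly_Mapping.keys f. Poly_Mapping.single \<mu> (Poly_Mapping.lookup f \<mu>))"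
  by (rule poly_mapping_eqI)
    (simp add: lookup_sum lookup_single when_def in_keys_iff)

lemma lookup_single_mult:
  fixes f :: "('v, 'k::comm_ring_1) mpoly"
  shows "Poly_Mapping.lookup (Poly_Mapping.single a c * f) (a + \<mu>) = c * Poly_Mapping.lookup f \<mu>"
proof -
  have "Poly_Mapping.single a c * f =
      (\<Sum>\<nu>\<in>Poly_Mapping.keys f. Poly_Mapping.single (a + \<nu>) (c * Poly_Mapping.lookup f \<nu>))"
    by (subst poly_mapping_sum_single[of f]) (simp add: sum_distrib_left mult_single)
  then show ?thesis
    by (simp add: lookup_sum lookup_single when_def in_keys_iff)
qed

lemma keys_single_mult:
  "Poly_Mapping.keys (Poly_Mapping.single a c * f) \<subseteq> (+) a ` Poly_Mapping.keys f"
  using keys_mult[of "Poly_Mapping.single a c" f] by (auto split: if_splits)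

lemma mono_deg_add: "mono_deg (a + b) = mono_deg a + mono_deg b"
  by (simp add: mono_deg_def lookup_add sum.distrib)

text \<open>The cutoff is an integer because degrees of forms are subtracted from it: a negative
  cutoff must give 0, whereas truncated subtraction would keep constants.\<close>

definition trunc :: "int \<Rightarrow> ('v::finite, 'k::comm_ring_1) mpoly \<Rightarrow> ('v, 'k) mpoly" where
  "trunc e f = Poly_Mapping.mapp (\<lambda>\<mu> c. if int (mono_deg \<mu>) \<le> e then c else 0) f"

lemma lookup_trunc:
  "Poly_Mapping.lookup (trunc e f) \<mu> =
    (if int (mono_deg \<mu>) \<le> e then Poly_Mapping.lookup f \<mu> else 0)"
  by (simp add: trunc_def lookup_mapp when_def in_keys_iff)

lemma trunc_add: "trunc e (f + g) = trunc e f + trunc e g"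
  by (rule poly_mapping_eqI) (simp add: lookup_trunc lookup_add)

lemma trunc_uminus: "trunc e (- f) = - trunc e f"
  by (rule poly_mapping_eqI) (simp add: lookup_trunc)

lemma trunc_zero: "trunc e 0 = 0"
  by (rule poly_mapping_eqI) (simp add: lookup_trunc)

lemma trunc_sum: "trunc e (sum f A) = (\<Sum>x\<in>A. trunc e (f x))"
  by (induction A rule: infinite_finite_induct) (simp_all add: trunc_zero trunc_add)

lemma trunc_neg: "e < 0 \<Longrightarrow> trunc e f = 0"
  by (rule poly_mapping_eqI) (simp add: lookup_trunc)

lemma trunc_eq_self:
  "(\<And>\<mu>. \<mu> \<in> Poly_Mapping.keys f \<Longrightarrow> int (mono_deg \<mu>) \<le> e) \<Longrightarrow> trunc e f = f"
  by (rule poly_mapping_eqI) (auto simp: lookup_trunc in_keys_iff)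

lemma trunc_single_mult:
  "trunc e (Poly_Mapping.single a c * f) = Poly_Mapping.single a c * trunc (e - int (mono_deg a)) f"
proof (rule poly_mapping_eqI)
  fix \<nu>
  let ?l = "Poly_Mapping.lookup (trunc e (Poly_Mapping.single a c * f)) \<nu>"
  let ?r = "Poly_Mapping.lookup (Poly_Mapping.single a c * trunc (e - int (mono_deg a)) f) \<nu>"
  show "?l = ?r"
  proof (cases "\<exists>\<mu>. \<nu> = a + \<mu>")
    case True
    then obtain \<mu> where "\<nu> = a + \<mu>" ..
    then show ?thesis by (auto simp: lookup_trunc lookup_single_mult mono_deg_add)
  next
    case False
    then have "Poly_Mapping.lookup (Poly_Mapping.single a c * g) \<nu> = 0" for g
      using keys_single_mult[of a c g] by (force simp: in_keys_iff)
    then show ?thesis by (simp add: lookup_trunc)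
  qed
qed

lemma trunc_mult:
  assumes "\<And>\<mu>. \<mu> \<in> Poly_Mapping.keys h \<Longrightarrow> mono_deg \<mu> = d"
  shows "trunc e (h * f) = h * trunc (e - int d) f"
proof -
  have "trunc e (h * f) = trunc e ((\<Sum>\<mu>\<in>Poly_Mapping.keys h.
      Poly_Mapping.single \<mu> (Poly_Mapping.lookup h \<mu>)) * f)"
    using poly_mapping_sum_single[of h] by simp
  also have "\<dots> = (\<Sum>\<mu>\<in>Poly_Mapping.keys h.
      Poly_Mapping.single \<mu> (Poly_Mapping.lookup h \<mu>) * trunc (e - int d) f)"
    by (simp add: sum_distrib_right trunc_sum trunc_single_mult assms)
  also have "\<dots> = h * trunc (e - int d) f"
    using poly_mapping_sum_single[of h] by (simp flip: sum_distrib_right)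
  finally show ?thesis .
qed

definition has_degree :: "nat \<Rightarrow> ('v::finite, 'k::comm_ring_1) mpoly \<Rightarrow> bool" where
  "has_degree d h \<longleftrightarrow> (\<forall>\<mu>\<in>Poly_Mapping.keys h. mono_deg \<mu> = d)"

text \<open>Note that 0 is a form of every degree.\<close>
definition positive_form :: "('v::finite, 'k::comm_ring_1) mpoly \<Rightarrow> bool" where
  "positive_form h \<longleftrightarrow> (\<exists>d\<ge>1. has_degree d h)"

text \<open>The zero form has every degree, so one positive degree is chosen.\<close>

definition form_degree :: "('v::finite, 'k::comm_ring_1) mpoly \<Rightarrow> nat" where
  "form_degree h = (SOME d. d \<ge> 1 \<and> has_degree d h)"

lemma form_degree:
  assumes "positive_form h"
  shows "form_degree h \<ge> 1" "has_degree (form_degree h) h"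
  using someI_ex[of "\<lambda>d. d \<ge> 1 \<and> has_degree d h"] assms
  by (auto simp: positive_form_def form_degree_def)

lemma trunc_form_mult:
  "positive_form h \<Longrightarrow> trunc e (h * f) = h * trunc (e - int (form_degree h)) f"
  using form_degree(2)[of h] by (intro trunc_mult) (auto simp: has_degree_def)

text \<open>The internal degree of a basis vector: giving each \<open>e_i\<close> the degree of its
  form makes the differential preserve internal degree, so truncation is a chain map.\<close>

fun word_weight :: "('v::finite, 'k::comm_ring_1) mpoly list \<Rightarrow> bool list \<Rightarrow> nat" where
  "word_weight (h # hs) (b # w) = (if b then form_degree h else 0) + word_weight hs w"
| "word_weight _ _ = 0"

lemma koszul_d_trunc:
  assumes "\<forall>h\<in>set hs. positive_form h" "length w = length hs"
  shows "koszul_d hs (\<lambda>w. trunc (e - int (word_weight hs w)) (z w)) w =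
    trunc (e - int (word_weight hs w)) (koszul_d hs z w)"
  using assms
proof (induction hs arbitrary: e z w)
  case Nil
  then show ?case by (simp add: trunc_zero)
next
  case (Cons h hs)
  obtain b u where w: "w = b # u" and u: "length u = length hs" using Cons.prems by (cases w) auto
  have IH: "koszul_d hs (\<lambda>w. trunc (e - int (word_weight hs w)) (y w)) u =
    trunc (e - int (word_weight hs u)) (koszul_d hs y u)" for e y
    using Cons.prems u by (intro Cons.IH) auto
  have h: "positive_form h" using Cons.prems by simp
  show ?case
  proof (cases b)
    case True
    then show ?thesis
      using IH[of "e - int (form_degree h)" "\<lambda>v. z (True # v)"]
      by (simp add: w trunc_uminus diff_diff_eq)
  next
    case False
    then show ?thesis
      using IH[of e "\<lambda>v. z (False # v)"]
      by (simp add: w trunc_add trunc_form_mult[OF h] diff_diff_eq add.commute)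
  qed
qed

text \<open>Graded Nakayama: iterating \<open>z = d v + h * z'\<close> pushes the unexplained
  remainder into ever higher powers of \<open>h\<close>, hence beyond any given degree. So every
  truncation of \<open>z\<close> bounds, and a large enough truncation is \<open>z\<close>
  itself.\<close>

lemma koszul_acyclic_tail:
  assumes ac: "koszul_acyclic (h # hs)" and pos: "\<forall>f\<in>set (h # hs). positive_form f"
  shows "koszul_acyclic hs"
  unfolding koszul_acyclic_def
proof (intro allI impI)
  fix z
  assume "koszul_supp (length hs) 1 z" "\<forall>w. length w = length hs \<longrightarrow> koszul_d hs z w = 0"
  have low: "\<exists>v. \<forall>w. length w = length hs \<longrightarrow>
      trunc (int n - int (word_weight hs w)) (z w) = koszul_d hs v w" for n
    using \<open>koszul_supp (length hs) 1 z\<close> \<open>\<forall>w. length w = length hs \<longrightarrow> koszul_d hs z w = 0\<close>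
  proof (induction n arbitrary: z rule: less_induct)
    case (less n)
    obtain v z' where z': "koszul_supp (length hs) 1 z'"
      "\<And>w. length w = length hs \<Longrightarrow> koszul_d hs z' w = 0"
      and z: "\<And>w. length w = length hs \<Longrightarrow> z w = koszul_d hs v w + h * z' w"
      using koszul_acyclic_ConsD[OF ac less.prems(1)] less.prems(2) by metis
    let ?d = "form_degree h"
    have h: "positive_form h" and d: "?d \<ge> 1" using pos form_degree(1)[of h] by auto
    \<comment> \<open>Pulling out \<open>h\<close> lowers the cutoff by \<open>?d \<ge> 1\<close>,
      so the induction applies to \<open>z'\<close>; once the cutoff is negative the truncation is
      0.\<close>
    have "\<exists>y. \<forall>w. length w = length hs \<longrightarrow>
        trunc (int n - int ?d - int (word_weight hs w)) (z' w) = koszul_d hs y w"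
    proof (cases "?d \<le> n")
      case True
      then show ?thesis
        using less.IH[of "n - ?d" z'] z' d by (simp add: of_nat_diff)
    next
      case False
      then show ?thesis
        by (intro exI[of _ "\<lambda>_. 0"]) (simp add: trunc_neg koszul_d_zero)
    qed
    then obtain y where y: "\<And>w. length w = length hs \<Longrightarrow>
        trunc (int n - int ?d - int (word_weight hs w)) (z' w) = koszul_d hs y w"
      by blast
    have "trunc (int n - int (word_weight hs w)) (z w) =
        koszul_d hs (\<lambda>w. trunc (int n - int (word_weight hs w)) (v w) + h * y w) w"
      if w: "length w = length hs" for w
    proof -
      have "trunc (int n - int (word_weight hs w)) (h * z' w) = h * koszul_d hs y w"
        using y[OF w] by (simp add: trunc_form_mult[OF h] algebra_simps)
      moreover have "koszul_d hs (\<lambda>w. trunc (int n - int (word_weight hs w)) (v w)) w =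
          trunc (int n - int (word_weight hs w)) (koszul_d hs v w)"
        using pos w by (intro koszul_d_trunc) auto
      ultimately show ?thesis
        by (simp add: z[OF w] trunc_add koszul_d_add koszul_d_mult)
    qed
    then show ?case by blast
  qed
  let ?W = "{w :: bool list. length w = length hs}"
  have fin: "finite ?W" using finite_lists_length_eq[of "UNIV :: bool set" "length hs"] by simp
  \<comment> \<open>A crude bound for all internal degrees in \<open>z\<close>, with sums in place
    of maxima over the finitely many words and monomials.\<close>
  define n where "n = (\<Sum>w\<in>?W. word_weight hs w + (\<Sum>\<mu>\<in>Poly_Mapping.keys (z w). mono_deg \<mu>))"
  have n: "trunc (int n - int (word_weight hs w)) (z w) = z w" if w: "length w = length hs" for w
  proof (rule trunc_eq_self)
    fix \<mu> assume "\<mu> \<in> Poly_Mapping.keys (z w)"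
    then have "mono_deg \<mu> \<le> (\<Sum>\<mu>\<in>Poly_Mapping.keys (z w). mono_deg \<mu>)"
      by (intro member_le_sum) auto
    moreover have "word_weight hs w + (\<Sum>\<mu>\<in>Poly_Mapping.keys (z w). mono_deg \<mu>) \<le> n"
      unfolding n_def using w fin
      by (intro member_le_sum[of w ?W "\<lambda>w. word_weight hs w + (\<Sum>\<mu>\<in>Poly_Mapping.keys (z w). mono_deg \<mu>)"]) auto
    ultimately show "int (mono_deg \<mu>) \<le> int n - int (word_weight hs w)" by linarith
  qed
  show "\<exists>v. \<forall>w. length w = length hs \<longrightarrow> z w = koszul_d hs v w"
    using low[of n] n by simp
qed

lemma koszul_acyclic_weakly_regular:
  "koszul_acyclic hs \<Longrightarrow> \<forall>f\<in>set hs. positive_form f \<Longrightarrow> weakly_regular {} hs"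
proof (induction hs)
  case (Cons h hs)
  have "weakly_regular {} hs"
    using Cons koszul_acyclic_tail[of h hs] by simp
  then show ?case using koszul_acyclic_regular[OF Cons.prems(1)] by simp
qed simp

section \<open>Powers of variables form a regular sequence\<close>

lemma var_power: "var v ^ n = Poly_Mapping.single (Poly_Mapping.single v n) 1"
proof (induction n)
  case 0
  then show ?case by (simp flip: single_one)
next
  case (Suc n)
  then show ?case by (simp add: var_def mult_single flip: single_add)
qed

lemma ideal_var_powers:
  fixes vs :: "'v list"
  shows "f \<in> ideal_gen (set (map (\<lambda>v. var v ^ n) vs)) \<longleftrightarrow>
    (\<forall>\<mu>\<in>Poly_Mapping.keys (f :: ('v, 'k::comm_ring_1) mpoly). \<exists>v\<in>set vs. n \<le> Poly_Mapping.lookup \<mu> v)"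
proof
  let ?G = "ideal_gen (set (map (\<lambda>v. var v ^ n) vs)) :: ('v, 'k) mpoly set"
  let ?M = "{f :: ('v, 'k) mpoly. \<forall>\<mu>\<in>Poly_Mapping.keys f. \<exists>v\<in>set vs. n \<le> Poly_Mapping.lookup \<mu> v}"
  have "is_ideal ?M"
    unfolding is_ideal_def
  proof (intro conjI ballI allI)
    fix a b assume "a \<in> ?M" "b \<in> ?M"
    then show "a + b \<in> ?M" using keys_add[of a b] by blast
  next
    fix a r assume a: "a \<in> ?M"
    show "r * a \<in> ?M"
    proof safe
      fix \<mu> assume "\<mu> \<in> Poly_Mapping.keys (r * a)"
      then obtain x y where "\<mu> = x + y" "y \<in> Poly_Mapping.keys a" using keys_mult[of r a] by blast
      then show "\<exists>v\<in>set vs. n \<le> Poly_Mapping.lookup \<mu> v"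
        using a by (fastforce simp: lookup_add intro: trans_le_add2)
    qed
  qed simp
  moreover have "set (map (\<lambda>v. var v ^ n) vs) \<subseteq> ?M"
    by (auto simp: var_power intro!: bexI)
  ultimately have "?G \<subseteq> ?M" by (rule ideal_gen_minimal)
  then show "f \<in> ?G \<Longrightarrow> \<forall>\<mu>\<in>Poly_Mapping.keys f. \<exists>v\<in>set vs. n \<le> Poly_Mapping.lookup \<mu> v" by blast
  assume f: "\<forall>\<mu>\<in>Poly_Mapping.keys f. \<exists>v\<in>set vs. n \<le> Poly_Mapping.lookup \<mu> v"
  have "Poly_Mapping.single \<mu> (Poly_Mapping.lookup f \<mu>) \<in> ?G" if \<mu>: "\<mu> \<in> Poly_Mapping.keys f" for \<mu>
  proof -
    obtain v where v: "v \<in> set vs" "n \<le> Poly_Mapping.lookup \<mu> v" using f \<mu> by blast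
    have "\<mu> = (\<mu> - Poly_Mapping.single v n) + Poly_Mapping.single v n"
      using v(2) by (intro poly_mapping_eqI) (auto simp: lookup_add lookup_minus lookup_single when_def)
    then have "Poly_Mapping.single \<mu> (Poly_Mapping.lookup f \<mu>) =
        Poly_Mapping.single (\<mu> - Poly_Mapping.single v n) (Poly_Mapping.lookup f \<mu>) * var v ^ n"
      by (simp add: var_power mult_single)
    moreover have "var v ^ n \<in> ?G" using v(1) by (intro in_ideal_genI) auto
    ultimately show ?thesis by (simp add: ideal_mult_left)
  qed
  then have "(\<Sum>\<mu>\<in>Poly_Mapping.keys f. Poly_Mapping.single \<mu> (Poly_Mapping.lookup f \<mu>)) \<in> ?G"
    by (intro ideal_sum) auto
  then show "f \<in> ?G" using poly_mapping_sum_single[of f] by simp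
qed

text \<open>Membership in a monomial ideal is tested on exponents, and multiplication by a power of
  \<open>v\<close> changes no exponent of the other variables.\<close>

lemma weakly_regular_var_powers:
  fixes vs :: "'v list"
  assumes "distinct vs"
  shows "weakly_regular {} (map (\<lambda>v. var v ^ n :: ('v, 'k::comm_ring_1) mpoly) vs)"
  using assms
proof (induction vs)
  case (Cons v vs)
  have "u \<in> ideal_gen (set (map (\<lambda>v. var v ^ n) vs))"
    if u: "var v ^ n * u \<in> ideal_gen (set (map (\<lambda>v. var v ^ n) vs))" for u :: "('v, 'k) mpoly"
    unfolding ideal_var_powers
  proof
    fix \<mu> assume "\<mu> \<in> Poly_Mapping.keys u"
    then have "Poly_Mapping.single v n + \<mu> \<in> Poly_Mapping.keys (var v ^ n * u)"
      by (simp add: var_power in_keys_iff lookup_single_mult)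
    then obtain w where "w \<in> set vs" "n \<le> Poly_Mapping.lookup (Poly_Mapping.single v n + \<mu>) w"
      using u unfolding ideal_var_powers by blast
    moreover have "w \<noteq> v" using Cons.prems \<open>w \<in> set vs\<close> by auto
    ultimately show "\<exists>v\<in>set vs. n \<le> Poly_Mapping.lookup \<mu> v"
      by (auto simp: lookup_add lookup_single)
  qed
  then show ?case using Cons by simp
qed simp

subsection \<open>Dimension of polynomial rings\<close>

text \<open>A common generalisation of regular sequences and chains of primes: each element is
  regular modulo the current ideal and lies in the next one, which may be larger than what has been
  generated. Hence one can be continued by the other.\<close>

fun ideal_flag :: "'a::comm_ring_1 set \<Rightarrow> 'a list \<Rightarrow> bool" where
  "ideal_flag I [] \<longleftrightarrow> is_ideal I \<and> I \<noteq> UNIV"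
| "ideal_flag I (z # zs) \<longleftrightarrow> is_ideal I \<and> (\<forall>u. z * u \<in> I \<longrightarrow> u \<in> I) \<and>
     (\<exists>I'. I \<subseteq> I' \<and> z \<in> I' \<and> ideal_flag I' zs)"

lemma ideal_flag_ideal: "ideal_flag I zs \<Longrightarrow> is_ideal I"
  by (cases zs) auto

fun monomial_of :: "'a::comm_ring_1 list \<Rightarrow> nat list \<Rightarrow> 'a" where
  "monomial_of (z # zs) (a # \<alpha>) = z ^ a * monomial_of zs \<alpha>"
| "monomial_of _ _ = 1"

text \<open>Among the exponents of a polynomial relation the lexicographically least one yields, after
  cancelling along the flag, that its coefficient lies in the last (proper) ideal.\<close>
lemma ideal_flag_independent:
  assumes "ideal_flag I zs" "finite E" "\<And>\<alpha>. \<alpha> \<in> E \<Longrightarrow> length \<alpha> = length zs"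
    "\<And>\<alpha>. \<alpha> \<in> E \<Longrightarrow> c \<alpha> dvd 1" "(\<Sum>\<alpha>\<in>E. c \<alpha> * monomial_of zs \<alpha>) \<in> I"
  shows "E = {}"
  using assms
proof (induction zs arbitrary: I E c)
  case Nil
  show ?case
  proof (rule ccontr)
    assume "E \<noteq> {}"
    then have E: "E = {[]}" using Nil.prems(3) by (metis length_0_conv list.size(3) subsetI subset_singletonD singleton_iff)
    then obtain d where "1 = c [] * d" using Nil.prems(4)[of "[]"] by (auto elim: dvdE)
    moreover have "c [] \<in> I" using Nil.prems(5) E by simp
    ultimately have "1 \<in> I" using Nil.prems(1) ideal_mult_right[of I "c []" d] by simp
    then show False using Nil.prems(1) ideal_UNIV_iff by auto
  qed
next
  case (Cons z zs)
  show ?case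
  proof (rule ccontr)
    assume "E \<noteq> {}"
    define m where "m = Min (hd ` E)"
    define F where "F = {\<beta>. m # \<beta> \<in> E}"
    have m: "m \<in> hd ` E" "\<And>\<alpha>. \<alpha> \<in> E \<Longrightarrow> m \<le> hd \<alpha>"
      using \<open>E \<noteq> {}\<close> Cons.prems(2) by (auto simp: m_def)
    have tl: "\<alpha> = hd \<alpha> # tl \<alpha>" if "\<alpha> \<in> E" for \<alpha>
      using Cons.prems(3)[OF that] by (cases \<alpha>) auto
    have F: "F \<noteq> {}"
    proof -
      obtain \<alpha> where "\<alpha> \<in> E" "hd \<alpha> = m" using m(1) by blast
      then have "tl \<alpha> \<in> F" using tl[of \<alpha>] unfolding F_def by (metis mem_Collect_eq)
      then show ?thesis by blast
    qed
    have inj: "inj_on ((#) m) F" by (auto simp: inj_on_def)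
    have img: "(#) m ` F \<subseteq> E" by (auto simp: F_def)
    have finF: "finite F" using finite_imageD[OF finite_subset[OF img Cons.prems(2)] inj] .
    obtain I' where reg: "\<And>u. z * u \<in> I \<Longrightarrow> u \<in> I" and I': "I \<subseteq> I'" "z \<in> I'" "ideal_flag I' zs"
      using Cons.prems(1) unfolding ideal_flag.simps by blast
    have idI': "is_ideal I'" using I'(3) by (rule ideal_flag_ideal)
    \<comment> \<open>The terms whose first exponent exceeds \<open>m\<close>, divided by
      \<open>z ^ (m + 1)\<close>. After \<open>z ^ m\<close> is cancelled modulo \<open>I\<close>,
      their contribution \<open>z * S\<close> lies in \<open>I'\<close>, and a relation in the
      remaining elements modulo \<open>I'\<close> is left.\<close>
    define S where "S = (\<Sum>\<alpha>\<in>E - (#) m ` F. c \<alpha> * (z ^ (hd \<alpha> - Suc m) * monomial_of zs (tl \<alpha>)))"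
    have rest: "c \<alpha> * monomial_of (z # zs) \<alpha> =
        z ^ m * (z * (c \<alpha> * (z ^ (hd \<alpha> - Suc m) * monomial_of zs (tl \<alpha>))))"
      if \<alpha>: "\<alpha> \<in> E - (#) m ` F" for \<alpha>
    proof -
      have "hd \<alpha> \<noteq> m" using \<alpha> tl[of \<alpha>] unfolding F_def by (metis DiffE imageI mem_Collect_eq)
      then have "m < hd \<alpha>" using m(2)[of \<alpha>] \<alpha> by auto
      then have "hd \<alpha> = m + Suc (hd \<alpha> - Suc m)" by simp
      then have "z ^ hd \<alpha> = z ^ m * (z * z ^ (hd \<alpha> - Suc m))"
        by (metis power_Suc power_add)
      moreover have "monomial_of (z # zs) \<alpha> = z ^ hd \<alpha> * monomial_of zs (tl \<alpha>)"
        using tl[of \<alpha>] \<alpha> by (metis DiffD1 monomial_of.simps(1))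
      ultimately show ?thesis by (simp add: mult_ac)
    qed
    have "(\<Sum>\<alpha>\<in>E. c \<alpha> * monomial_of (z # zs) \<alpha>) =
        (\<Sum>\<alpha>\<in>E - (#) m ` F. c \<alpha> * monomial_of (z # zs) \<alpha>) +
        (\<Sum>\<alpha>\<in>(#) m ` F. c \<alpha> * monomial_of (z # zs) \<alpha>)"
      by (rule sum.subset_diff[OF img Cons.prems(2)])
    also have "(\<Sum>\<alpha>\<in>E - (#) m ` F. c \<alpha> * monomial_of (z # zs) \<alpha>) = z ^ m * (z * S)"
      unfolding S_def sum_distrib_left by (rule sum.cong[OF refl rest])
    also have "(\<Sum>\<alpha>\<in>(#) m ` F. c \<alpha> * monomial_of (z # zs) \<alpha>) =
        z ^ m * (\<Sum>\<beta>\<in>F. c (m # \<beta>) * monomial_of zs \<beta>)"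
      by (simp add: sum.reindex[OF inj] sum_distrib_left mult_ac)
    finally have "z ^ m * (z * S + (\<Sum>\<beta>\<in>F. c (m # \<beta>) * monomial_of zs \<beta>)) \<in> I"
      using Cons.prems(5) by (simp add: distrib_left)
    moreover have "u \<in> I" if "z ^ k * u \<in> I" for k u
      using that by (induction k) (simp, metis reg mult.assoc power_Suc)
    ultimately have "z * S + (\<Sum>\<beta>\<in>F. c (m # \<beta>) * monomial_of zs \<beta>) \<in> I'"
      using I'(1) by (meson subsetD)
    moreover have "z * S \<in> I'" using idI' I'(2) by (rule ideal_mult_right)
    ultimately have "z * S + (\<Sum>\<beta>\<in>F. c (m # \<beta>) * monomial_of zs \<beta>) - z * S \<in> I'"
      by (rule ideal_diff[OF idI'])
    then have "(\<Sum>\<beta>\<in>F. c (m # \<beta>) * monomial_of zs \<beta>) \<in> I'" by simp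
    moreover have "length \<beta> = length zs" if "\<beta> \<in> F" for \<beta>
      using Cons.prems(3)[of "m # \<beta>"] that by (simp add: F_def)
    moreover have "c (m # \<beta>) dvd 1" if "\<beta> \<in> F" for \<beta>
      using Cons.prems(4)[of "m # \<beta>"] that by (simp add: F_def)
    ultimately have "F = {}" using Cons.IH[OF I'(3) finF, of "\<lambda>\<beta>. c (m # \<beta>)"] by blast
    then show False using F by blast
  qed
qed

section \<open>Algebraic dependence by counting monomials\<close>

lemma nontrivial_linear_solution:
  fixes M :: "'a \<Rightarrow> 'b \<Rightarrow> 'k::field"
  assumes "finite B" "finite A" "card B < card A"
  shows "\<exists>c. (\<exists>a\<in>A. c a \<noteq> 0) \<and> (\<forall>b\<in>B. (\<Sum>a\<in>A. c a * M a b) = 0)"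
  using assms
proof (induction B arbitrary: A M rule: finite_induct)
  case empty
  then have "A \<noteq> {}" by auto
  then show ?case by (intro exI[of _ "\<lambda>_. 1"]) auto
next
  case (insert b B)
  show ?case
  proof (cases "\<forall>a\<in>A. M a b = 0")
    case True
    have "card B < card A" using insert.prems insert.hyps by simp
    then show ?thesis using insert.IH[OF insert.prems(1), of M] True by auto
  next
    case False
    then obtain p where p: "p \<in> A" "M p b \<noteq> 0" by blast
    \<comment> \<open>Gaussian elimination: the pivot entry at \<open>p\<close> clears equation
      \<open>b\<close>, and \<open>- s\<close> is the value that this equation forces on the unknown
      \<open>p\<close>.\<close>
    define M' where "M' a x = M a x - M a b / M p b * M p x" for a x
    have "card B < card (A - {p})" using insert.prems insert.hyps p by simp
    then obtain c where c: "\<exists>a\<in>A - {p}. c a \<noteq> 0" "\<forall>x\<in>B. (\<Sum>a\<in>A - {p}. c a * M' a x) = 0"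
      using insert.IH[of "A - {p}" M'] insert.prems(1) by auto
    define s where "s = (\<Sum>a\<in>A - {p}. c a * (M a b / M p b))"
    define d where "d a = (if a = p then - s else c a)" for a
    have split: "(\<Sum>a\<in>A. d a * M a x) = (\<Sum>a\<in>A - {p}. c a * M' a x)" for x
    proof -
      have "(\<Sum>a\<in>A. d a * M a x) = d p * M p x + (\<Sum>a\<in>A - {p}. d a * M a x)"
        using insert.prems(1) p(1) by (rule sum.remove)
      also have "(\<Sum>a\<in>A - {p}. d a * M a x) = (\<Sum>a\<in>A - {p}. c a * M a x)"
        by (rule sum.cong) (auto simp: d_def)
      also have "d p * M p x + (\<Sum>a\<in>A - {p}. c a * M a x) = (\<Sum>a\<in>A - {p}. c a * M' a x)"
        by (simp add: d_def s_def M'_def right_diff_distrib sum_subtractf sum_distrib_right mult.assoc)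
      finally show ?thesis .
    qed
    have "(\<Sum>a\<in>A - {p}. c a * M' a b) = 0" using p(2) by (simp add: M'_def)
    then have "\<forall>x\<in>insert b B. (\<Sum>a\<in>A. d a * M a x) = 0" using c(2) split by auto
    moreover have "\<exists>a\<in>A. d a \<noteq> 0" using c(1) by (auto simp: d_def)
    ultimately show ?thesis by blast
  qed
qed

text \<open>Each exponent is bounded separately, rather than the total degree, so that the
  admissible monomials fill a box and are trivially counted.\<close>

definition exponents_le :: "nat \<Rightarrow> ('v, 'k::comm_ring_1) mpoly \<Rightarrow> bool" where
  "exponents_le e f \<longleftrightarrow> (\<forall>\<mu>\<in>Poly_Mapping.keys f. \<forall>v. Poly_Mapping.lookup \<mu> v \<le> e)"

lemma exponents_le_one: "exponents_le e 1"
  by (simp add: exponents_le_def)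

lemma exponents_le_mult:
  assumes "exponents_le d f" "exponents_le e g"
  shows "exponents_le (d + e) (f * g)"
  unfolding exponents_le_def
proof (intro ballI allI)
  fix \<mu> v assume "\<mu> \<in> Poly_Mapping.keys (f * g)"
  then obtain a b where "\<mu> = a + b" "a \<in> Poly_Mapping.keys f" "b \<in> Poly_Mapping.keys g"
    using keys_mult[of f g] by blast
  then show "Poly_Mapping.lookup \<mu> v \<le> d + e"
    using assms by (auto simp: exponents_le_def lookup_add add_mono)
qed

lemma exponents_le_power: "exponents_le d f \<Longrightarrow> exponents_le (n * d) (f ^ n)"
  by (induction n) (auto simp: exponents_le_one intro: exponents_le_mult)

lemma exponents_le_monomial_of:
  "\<forall>z\<in>set zs. exponents_le d z \<Longrightarrow> exponents_le (sum_list \<alpha> * d) (monomial_of zs \<alpha>)"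
proof (induction zs \<alpha> rule: monomial_of.induct)
  case (1 z zs a \<alpha>)
  then show ?case
    using exponents_le_mult[OF exponents_le_power[of d z a], of "sum_list \<alpha> * d" "monomial_of zs \<alpha>"]
    by (simp add: distrib_right)
qed (simp_all add: exponents_le_one)

lemma exponents_le_mono: "exponents_le d f \<Longrightarrow> d \<le> e \<Longrightarrow> exponents_le e f"
  unfolding exponents_le_def by (meson order_trans)

lemma exponents_le_ex:
  fixes F :: "('v::finite, 'k::comm_ring_1) mpoly set"
  assumes "finite F"
  shows "\<exists>d. \<forall>f\<in>F. exponents_le d f"
proof -
  define d where "d = (\<Sum>f\<in>F. \<Sum>\<mu>\<in>Poly_Mapping.keys f. mono_deg \<mu>)"
  have "Poly_Mapping.lookup \<mu> v \<le> d" if "f \<in> F" "\<mu> \<in> Poly_Mapping.keys f" for f \<mu> v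
  proof -
    have "Poly_Mapping.lookup \<mu> v \<le> mono_deg \<mu>"
      unfolding mono_deg_def by (rule member_le_sum) auto
    also have "\<dots> \<le> (\<Sum>\<mu>\<in>Poly_Mapping.keys f. mono_deg \<mu>)"
      using that by (intro member_le_sum) auto
    also have "\<dots> \<le> d" unfolding d_def
      using that assms by (intro member_le_sum[of f F "\<lambda>f. \<Sum>\<mu>\<in>Poly_Mapping.keys f. mono_deg \<mu>"]) auto
    finally show ?thesis .
  qed
  then show ?thesis unfolding exponents_le_def by blast
qed

lemma card_bounded_exponents:
  fixes D :: nat
  defines "B \<equiv> {\<mu> :: 'v::finite \<Rightarrow>\<^sub>0 nat. \<forall>v. Poly_Mapping.lookup \<mu> v < D}"
  shows "finite B" "card B \<le> D ^ card (UNIV :: 'v set)"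
proof -
  let ?P = "PiE (UNIV :: 'v set) (\<lambda>_. {..<D})"
  have inj: "inj_on Poly_Mapping.lookup B"
    by (rule inj_onI) (metis poly_mapping_eqI)
  have sub: "Poly_Mapping.lookup ` B \<subseteq> ?P" by (auto simp: B_def)
  have fin: "finite ?P" by (intro finite_PiE) auto
  show "finite B" using finite_imageD[OF finite_subset[OF sub fin] inj] .
  have "card B \<le> card ?P" by (rule card_inj_on_le[OF inj sub fin])
  then show "card B \<le> D ^ card (UNIV :: 'v set)" by (simp add: card_PiE)
qed

text \<open>With all exponents below \<open>M\<close> there are \<open>M ^ N\<close> products of the
  N given polynomials, while the monomials occurring in them fill a box whose side grows linearly in
  \<open>M\<close>. As N exceeds the number n of variables, the products outnumber the monomials for
  large \<open>M\<close>.\<close>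

lemma algebraic_dependence:
  fixes zs :: "('v::finite, 'k::field) mpoly list"
  assumes "card (UNIV :: 'v set) < length zs"
  shows "\<exists>E c. finite E \<and> E \<noteq> {} \<and> (\<forall>\<alpha>\<in>E. length \<alpha> = length zs \<and> c \<alpha> \<noteq> 0) \<and>
    (\<Sum>\<alpha>\<in>E. Poly_Mapping.single 0 (c \<alpha>) * monomial_of zs \<alpha>) = 0"
proof -
  let ?n = "card (UNIV :: 'v set)" and ?N = "length zs"
  obtain d where d: "\<forall>z\<in>set zs. exponents_le d z" using exponents_le_ex[of "set zs"] by auto
  \<comment> \<open>The side \<open>D\<close> exceeds every exponent in these products and satisfies
    \<open>D \<le> M * C\<close>. The choice of \<open>M\<close> gives
    \<open>D ^ n \<le> M ^ n * C ^ n < M ^ (n + 1) \<le> M ^ N\<close>.\<close>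
  define C where "C = ?N * d + 1"
  define M where "M = C ^ ?n + 1"
  define D where "D = ?N * M * d + 1"
  define A where "A = {\<alpha>. set \<alpha> \<subseteq> {..<M} \<and> length \<alpha> = ?N}"
  define B where "B = {\<mu> :: 'v \<Rightarrow>\<^sub>0 nat. \<forall>v. Poly_Mapping.lookup \<mu> v < D}"
  have finA: "finite A" unfolding A_def by (rule finite_lists_length_eq) simp
  have cardA: "card A = M ^ ?N" unfolding A_def using card_lists_length_eq[of "{..<M}" ?N] by simp
  have finB: "finite B" and cardB: "card B \<le> D ^ ?n"
    unfolding B_def by (rule card_bounded_exponents)+
  have M1: "M \<ge> 1" by (simp add: M_def)
  have "D \<le> M * C" using M1 by (simp add: D_def C_def algebra_simps)
  then have "D ^ ?n \<le> M ^ ?n * C ^ ?n" by (metis power_mono power_mult_distrib le0)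
  also have "\<dots> < M ^ ?n * M" using M1 by (simp add: M_def)
  also have "\<dots> = M ^ Suc ?n" by simp
  also have "\<dots> \<le> M ^ ?N" using assms M1 by (intro power_increasing) auto
  finally have "card B < card A" using cardA cardB by linarith
  then obtain c where c: "\<exists>\<alpha>\<in>A. c \<alpha> \<noteq> 0"
    "\<forall>\<mu>\<in>B. (\<Sum>\<alpha>\<in>A. c \<alpha> * Poly_Mapping.lookup (monomial_of zs \<alpha>) \<mu>) = 0"
    using nontrivial_linear_solution[OF finB finA, of "\<lambda>\<alpha> \<mu>. Poly_Mapping.lookup (monomial_of zs \<alpha>) \<mu>"]
    by blast
  have outside: "Poly_Mapping.lookup (monomial_of zs \<alpha>) \<mu> = 0" if "\<alpha> \<in> A" "\<mu> \<notin> B" for \<alpha> \<mu>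
  proof (rule ccontr)
    assume "Poly_Mapping.lookup (monomial_of zs \<alpha>) \<mu> \<noteq> 0"
    then have "\<mu> \<in> Poly_Mapping.keys (monomial_of zs \<alpha>)" by (simp add: in_keys_iff)
    moreover have "sum_list \<alpha> \<le> ?N * M"
      using sum_list_mono[of \<alpha> "\<lambda>x. x" "\<lambda>_. M"] that(1)
      by (auto simp: A_def sum_list_triv less_imp_le subset_iff)
    then have "exponents_le (?N * M * d) (monomial_of zs \<alpha>)"
      by (intro exponents_le_mono[OF exponents_le_monomial_of[OF d]] mult_right_mono) auto
    ultimately have "\<mu> \<in> B" unfolding exponents_le_def B_def D_def by (auto simp: less_Suc_eq_le)
    then show False using that(2) by simp
  qed
  define E where "E = {\<alpha>\<in>A. c \<alpha> \<noteq> 0}"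
  show ?thesis
  proof (intro exI[of _ E] exI[of _ c] conjI)
    show "finite E" "E \<noteq> {}" using finA c(1) by (auto simp: E_def)
    show "\<forall>\<alpha>\<in>E. length \<alpha> = length zs \<and> c \<alpha> \<noteq> 0"
      by (auto simp: E_def A_def)
    show "(\<Sum>\<alpha>\<in>E. Poly_Mapping.single 0 (c \<alpha>) * monomial_of zs \<alpha>) = 0"
    proof (rule poly_mapping_eqI)
      fix \<mu>
      have "Poly_Mapping.lookup (Poly_Mapping.single 0 a * f) \<mu> = a * Poly_Mapping.lookup f \<mu>"
        for a and f :: "('v, 'k) mpoly"
        using lookup_single_mult[of 0 a f \<mu>] by simp
      then have "Poly_Mapping.lookup (\<Sum>\<alpha>\<in>E. Poly_Mapping.single 0 (c \<alpha>) * monomial_of zs \<alpha>) \<mu> =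
          (\<Sum>\<alpha>\<in>E. c \<alpha> * Poly_Mapping.lookup (monomial_of zs \<alpha>) \<mu>)"
        by (simp add: lookup_sum)
      also have "\<dots> = (\<Sum>\<alpha>\<in>A. c \<alpha> * Poly_Mapping.lookup (monomial_of zs \<alpha>) \<mu>)"
        using finA by (intro sum.mono_neutral_left) (auto simp: E_def)
      also have "\<dots> = 0" using c(2) outside by (cases "\<mu> \<in> B") auto
      finally show "Poly_Mapping.lookup (\<Sum>\<alpha>\<in>E. Poly_Mapping.single 0 (c \<alpha>) * monomial_of zs \<alpha>) \<mu> =
          Poly_Mapping.lookup 0 \<mu>" by simp
    qed
  qed
qed

lemma single_zero_dvd_one:
  fixes c :: "'k::field"
  assumes "c \<noteq> 0"
  shows "(Poly_Mapping.single 0 c :: ('v, 'k) mpoly) dvd 1"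
proof
  show "(1 :: ('v, 'k) mpoly) = Poly_Mapping.single 0 c * Poly_Mapping.single 0 (inverse c)"
    using assms by (simp add: mult_single)
qed

lemma ideal_flag_length:
  fixes zs :: "('v::finite, 'k::field) mpoly list"
  assumes "ideal_flag I zs"
  shows "length zs \<le> card (UNIV :: 'v set)"
proof (rule ccontr)
  assume "\<not> length zs \<le> card (UNIV :: 'v set)"
  then have "card (UNIV :: 'v set) < length zs" by simp
  from algebraic_dependence[OF this]
  obtain E c where E: "finite E" "E \<noteq> {}" "\<forall>\<alpha>\<in>E. length \<alpha> = length zs \<and> c \<alpha> \<noteq> 0"
    "(\<Sum>\<alpha>\<in>E. Poly_Mapping.single 0 (c \<alpha>) * monomial_of zs \<alpha>) = 0"
    by blast
  have "E = {}"
  proof (rule ideal_flag_independent[OF assms E(1)])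
    show "length \<alpha> = length zs" "Poly_Mapping.single 0 (c \<alpha>) dvd (1 :: ('v, 'k) mpoly)"
      if "\<alpha> \<in> E" for \<alpha>
      using E(3) that by (simp_all add: single_zero_dvd_one)
    show "(\<Sum>\<alpha>\<in>E. Poly_Mapping.single 0 (c \<alpha>) * monomial_of zs \<alpha>) \<in> I"
      unfolding E(4) by (rule ideal_zero[OF ideal_flag_ideal[OF assms]])
  qed
  then show False using E(2) by simp
qed

section \<open>Flags from prime chains and regular sequences\<close>

lemma prime_chain_flag:
  assumes "\<And>i. i \<le> j + n \<Longrightarrow> is_prime_ideal (P i)" "\<And>i. i < j + n \<Longrightarrow> P i \<subset> P (Suc i)"
  obtains zs where "length zs = n" "ideal_flag (P j) zs"
proof -
  have "\<exists>zs. length zs = n \<and> ideal_flag (P j) zs"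
    using assms
  proof (induction n arbitrary: j)
    case 0
    then show ?case by (intro exI[of _ "[]"]) (auto simp: is_prime_ideal_def)
  next
    case (Suc n)
    have "\<exists>zs. length zs = n \<and> ideal_flag (P (Suc j)) zs"
    proof (rule Suc.IH)
      show "is_prime_ideal (P i)" if "i \<le> Suc j + n" for i
        using that by (intro Suc.prems(1)) simp
      show "P i \<subset> P (Suc i)" if "i < Suc j + n" for i
        using that by (intro Suc.prems(2)) simp
    qed
    then obtain zs where zs: "length zs = n" "ideal_flag (P (Suc j)) zs" by blast
    have sub: "P j \<subset> P (Suc j)" by (rule Suc.prems(2)) simp
    then obtain z where z: "z \<in> P (Suc j)" "z \<notin> P j" by blast
    have "is_prime_ideal (P j)" by (rule Suc.prems(1)) simp
    then have "is_ideal (P j)" "\<forall>u. z * u \<in> P j \<longrightarrow> u \<in> P j"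
      using z(2) unfolding is_prime_ideal_def by blast+
    then have "ideal_flag (P j) (z # zs)"
      unfolding ideal_flag.simps using zs(2) z(1) sub by blast
    then show ?case using zs(1) by (intro exI[of _ "z # zs"]) simp
  qed
  then show thesis using that by blast
qed

lemma regular_sequence_prime_chain:
  fixes fs :: "('v::finite, 'k::field) mpoly list"
  assumes reg: "regular_sequence fs" and chain: "prime_chain_above (ideal_gen (set fs)) d"
  shows "length fs + d \<le> card (UNIV :: 'v set)"
proof -
  obtain P where P: "ideal_gen (set fs) \<subseteq> P 0" "\<forall>i\<le>d. is_prime_ideal (P i)" "\<forall>i<d. P i \<subset> P (Suc i)"
    using chain unfolding prime_chain_above_def by blast
  obtain zs where zs: "length zs = d" "ideal_flag (P 0) zs"
    using prime_chain_flag[of 0 d P] P(2,3) by (metis add_0)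
  \<comment> \<open>Downward induction, since a flag is assembled from its end: start with the flag
    of the prime chain above all of \<open>fs\<close> and prepend the elements of \<open>fs\<close>
    from last to first.\<close>
  have "\<exists>I. ideal_gen (set (take 0 fs)) \<subseteq> I \<and> ideal_flag I (drop 0 fs @ zs)"
  proof (rule inc_induct[where P = "\<lambda>k. \<exists>I. ideal_gen (set (take k fs)) \<subseteq> I \<and> ideal_flag I (drop k fs @ zs)"])
    show "0 \<le> length fs" by simp
    show "\<exists>I. ideal_gen (set (take (length fs) fs)) \<subseteq> I \<and> ideal_flag I (drop (length fs) fs @ zs)"
      using P(1) zs(2) by auto
    fix k assume k: "k < length fs"
      and "\<exists>I. ideal_gen (set (take (Suc k) fs)) \<subseteq> I \<and> ideal_flag I (drop (Suc k) fs @ zs)"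
    then obtain I where I: "ideal_gen (set (take (Suc k) fs)) \<subseteq> I" "ideal_flag I (drop (Suc k) fs @ zs)"
      by blast
    have "fs ! k \<in> set (take (Suc k) fs)" using k by (simp add: take_Suc_conv_app_nth)
    then have "fs ! k \<in> I" using I(1) in_ideal_genI by blast
    moreover have "ideal_gen (set (take k fs)) \<subseteq> I"
      using I(1) ideal_gen_mono[OF set_take_subset_set_take[of k "Suc k" fs]] by auto
    moreover have "\<forall>u. fs ! k * u \<in> ideal_gen (set (take k fs)) \<longrightarrow> u \<in> ideal_gen (set (take k fs))"
      using k reg unfolding regular_sequence_def by blast
    ultimately have "ideal_flag (ideal_gen (set (take k fs))) (fs ! k # drop (Suc k) fs @ zs)"
      using I(2) is_ideal_gen[of "set (take k fs)"] unfolding ideal_flag.simps by blast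
    moreover have "fs ! k # drop (Suc k) fs @ zs = drop k fs @ zs"
      using k by (simp flip: Cons_nth_drop_Suc)
    ultimately show "\<exists>I. ideal_gen (set (take k fs)) \<subseteq> I \<and> ideal_flag I (drop k fs @ zs)"
      by (metis order_refl)
  qed
  then obtain I where "ideal_flag I (fs @ zs)" by auto
  then have "length (fs @ zs) \<le> card (UNIV :: 'v set)" by (rule ideal_flag_length)
  then show ?thesis using zs(1) by simp
qed

subsection \<open>Noetherianity and associated primes\<close>

lemma mono_subsequence:
  fixes f :: "nat \<Rightarrow> nat"
  shows "\<exists>r :: nat \<Rightarrow> nat. strict_mono r \<and> mono (\<lambda>n. f (r n))"
proof -
  obtain r where r: "strict_mono r" "monoseq (\<lambda>n. f (r n))" using seq_monosub by blast
  show ?thesis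
  proof (cases "mono (\<lambda>n. f (r n))")
    case True
    with r(1) show ?thesis by (intro exI[of _ r] conjI)
  next
    case False
    then have dec: "f (r n) \<le> f (r m)" if "m \<le> n" for m n
      using r(2) that unfolding monoseq_def monotone_def by blast
    \<comment> \<open>A nonincreasing sequence of naturals is constant from an index of its least
      value on, so this tail is monotone.\<close>
    obtain k where k: "\<And>n. f (r k) \<le> f (r n)"
      using ex_has_least_nat[of "\<lambda>_. True" 0 "\<lambda>n. f (r n)"] by auto
    have const: "f (r (k + n)) = f (r k)" for n using k dec[of k "k + n"] by (simp add: antisym)
    have "strict_mono (\<lambda>n. r (k + n))" using r(1) by (simp add: strict_mono_def)
    moreover have "mono (\<lambda>n. f (r (k + n)))" by (simp add: const mono_def)
    ultimately show ?thesis by (intro exI[of _ "\<lambda>n. r (k + n)"] conjI)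
  qed
qed

text \<open>Refining to a subsequence once per variable makes all exponents nondecreasing at the
  same time; its first two terms then serve.\<close>

lemma dickson:
  fixes a :: "nat \<Rightarrow> ('v::finite \<Rightarrow>\<^sub>0 nat)"
  shows "\<exists>i j. i < j \<and> (\<forall>v. Poly_Mapping.lookup (a i) v \<le> Poly_Mapping.lookup (a j) v)"
proof -
  have "\<exists>r :: nat \<Rightarrow> nat. strict_mono r \<and> (\<forall>v\<in>V. mono (\<lambda>n. Poly_Mapping.lookup (a (r n)) v))" if "finite V" for V
    using that
  proof (induction V rule: finite_induct)
    case empty
    show ?case by (intro exI[of _ "\<lambda>n. n"]) (simp add: strict_mono_def)
  next
    case (insert w V)
    then obtain r :: "nat \<Rightarrow> nat" where r: "strict_mono r" "\<forall>v\<in>V. mono (\<lambda>n. Poly_Mapping.lookup (a (r n)) v)" by blast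
    obtain q :: "nat \<Rightarrow> nat" where q: "strict_mono q" "mono (\<lambda>n. Poly_Mapping.lookup (a (r (q n))) w)"
      using mono_subsequence[of "\<lambda>n. Poly_Mapping.lookup (a (r n)) w"] by blast
    have "strict_mono (\<lambda>n. r (q n))" using r(1) q(1) by (simp add: strict_mono_def)
    moreover have "mono (\<lambda>n. Poly_Mapping.lookup (a (r (q n))) v)" if "v \<in> V" for v
    proof (rule monoI)
      fix m n :: nat assume "m \<le> n"
      then have "q m \<le> q n" using q(1) by (simp add: strict_mono_less_eq)
      moreover have "mono (\<lambda>n. Poly_Mapping.lookup (a (r n)) v)" using r(2) that by blast
      ultimately show "Poly_Mapping.lookup (a (r (q m))) v \<le> Poly_Mapping.lookup (a (r (q n))) v"
        by (rule monoD[rotated])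
    qed
    ultimately show ?case using q(2) by (intro exI[of _ "\<lambda>n. r (q n)"] conjI ballI) auto
  qed
  then obtain r :: "nat \<Rightarrow> nat" where r: "strict_mono r" "\<forall>v. mono (\<lambda>n. Poly_Mapping.lookup (a (r n)) v)"
    by (metis UNIV_I finite)
  show ?thesis
  proof (intro exI conjI allI)
    show "r 0 < r 1" using r(1) by (simp add: strict_mono_def)
    fix v
    have "mono (\<lambda>n. Poly_Mapping.lookup (a (r n)) v)" using r(2) by blast
    then show "Poly_Mapping.lookup (a (r 0)) v \<le> Poly_Mapping.lookup (a (r 1)) v"
      by (rule monoD) simp
  qed
qed

text \<open>The index type carries no order, so an arbitrary injection into the naturals provides
  one for the lexicographic comparison.\<close>

definition var_rank :: "'v::finite \<Rightarrow> nat" where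
  "var_rank = (SOME g. inj g)"

lemma inj_var_rank: "inj (var_rank :: 'v::finite \<Rightarrow> nat)"
proof -
  have "\<exists>g :: 'v \<Rightarrow> nat. inj g"
    using finite_imp_inj_to_nat_seg[OF finite[of "UNIV :: 'v set"]] by blast
  then show ?thesis unfolding var_rank_def by (rule someI_ex)
qed

definition lex_less :: "('v::finite \<Rightarrow>\<^sub>0 nat) \<Rightarrow> ('v \<Rightarrow>\<^sub>0 nat) \<Rightarrow> bool" where
  "lex_less a b \<longleftrightarrow> (\<exists>v. Poly_Mapping.lookup a v < Poly_Mapping.lookup b v \<and>
    (\<forall>w. var_rank w < var_rank v \<longrightarrow> Poly_Mapping.lookup a w = Poly_Mapping.lookup b w))"

lemma lex_less_add: "lex_less a b \<Longrightarrow> lex_less (c + a) (c + b)"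
  by (simp add: lex_less_def lookup_add)

lemma lex_less_linear: "a = b \<or> lex_less a b \<or> lex_less b a"
proof (cases "a = b")
  case False
  have "\<exists>v. Poly_Mapping.lookup a v \<noteq> Poly_Mapping.lookup b v"
    using False by (metis poly_mapping_eqI)
  then obtain v where v: "Poly_Mapping.lookup a v \<noteq> Poly_Mapping.lookup b v"
    and least: "\<And>w. Poly_Mapping.lookup a w \<noteq> Poly_Mapping.lookup b w \<Longrightarrow> var_rank v \<le> var_rank w"
    using ex_has_least_nat[of "\<lambda>v. Poly_Mapping.lookup a v \<noteq> Poly_Mapping.lookup b v" _ var_rank] by blast
  have below: "\<forall>w. var_rank w < var_rank v \<longrightarrow> Poly_Mapping.lookup a w = Poly_Mapping.lookup b w"
    using least leD by blast
  show ?thesis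
  proof (cases "Poly_Mapping.lookup a v < Poly_Mapping.lookup b v")
    case True
    then have "lex_less a b" unfolding lex_less_def using below by (intro exI[of _ v]) simp
    then show ?thesis by blast
  next
    case False
    then have "Poly_Mapping.lookup b v < Poly_Mapping.lookup a v" using v by simp
    then have "lex_less b a" unfolding lex_less_def using below by (intro exI[of _ v]) simp
    then show ?thesis by blast
  qed
qed simp

lemma lex_less_trans:
  assumes "lex_less a b" "lex_less b c"
  shows "lex_less a c"
proof -
  obtain v where v: "Poly_Mapping.lookup a v < Poly_Mapping.lookup b v"
    "\<And>w. var_rank w < var_rank v \<Longrightarrow> Poly_Mapping.lookup a w = Poly_Mapping.lookup b w"
    using assms(1) unfolding lex_less_def by blast
  obtain x where x: "Poly_Mapping.lookup b x < Poly_Mapping.lookup c x"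
    "\<And>w. var_rank w < var_rank x \<Longrightarrow> Poly_Mapping.lookup b w = Poly_Mapping.lookup c w"
    using assms(2) unfolding lex_less_def by blast
  consider "var_rank v < var_rank x" | "var_rank x < var_rank v" | "v = x"
    using inj_var_rank by (metis inj_eq linorder_neqE_nat)
  then show ?thesis
  proof cases
    case 1
    then show ?thesis unfolding lex_less_def using v x by (intro exI[of _ v]) auto
  next
    case 2
    then show ?thesis unfolding lex_less_def using v x by (intro exI[of _ x]) auto
  next
    case 3
    then show ?thesis unfolding lex_less_def using v x by (intro exI[of _ v]) auto
  qed
qed

lemma lex_less_not_ge:
  assumes "\<And>v. Poly_Mapping.lookup a v \<le> Poly_Mapping.lookup b v"
  shows "\<not> lex_less b a"
  unfolding lex_less_def using assms by (meson not_le)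

text \<open>By Dickson, an infinite descent contains an earlier exponent that is componentwise at
  most a later one, and the later one cannot be lexicographically smaller.\<close>

lemma wf_lex_less: "wf {(a :: 'v::finite \<Rightarrow>\<^sub>0 nat, b). lex_less a b}"
  unfolding wf_iff_no_infinite_down_chain
proof
  assume "\<exists>f. \<forall>i. (f (Suc i), f i) \<in> {(a :: 'v \<Rightarrow>\<^sub>0 nat, b). lex_less a b}"
  then obtain f :: "nat \<Rightarrow> 'v \<Rightarrow>\<^sub>0 nat" where f: "\<And>i. lex_less (f (Suc i)) (f i)" by blast
  have less: "lex_less (f j) (f i)" if "i < j" for i j
    using that
  proof (induction j)
    case (Suc j)
    then show ?case using f[of j] by (cases "i = j") (auto intro: lex_less_trans)
  qed simp
  obtain i j where "i < j" "\<forall>v. Poly_Mapping.lookup (f i) v \<le> Poly_Mapping.lookup (f j) v"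
    using dickson by blast
  then show False using less[of i j] lex_less_not_ge by blast
qed

definition leading :: "('v::finite \<Rightarrow>\<^sub>0 nat) \<Rightarrow> ('v, 'k::comm_ring_1) mpoly \<Rightarrow> bool" where
  "leading \<mu> f \<longleftrightarrow> \<mu> \<in> Poly_Mapping.keys f \<and> (\<forall>\<nu>\<in>Poly_Mapping.keys f. \<nu> = \<mu> \<or> lex_less \<nu> \<mu>)"

lemma leading_ex:
  assumes "f \<noteq> 0"
  shows "\<exists>\<mu>. leading \<mu> f"
proof -
  have "\<exists>\<mu>\<in>A. \<forall>\<nu>\<in>A. \<nu> = \<mu> \<or> lex_less \<nu> \<mu>" if "finite A" "A \<noteq> {}" for A :: "('a \<Rightarrow>\<^sub>0 nat) set"
    using that
  proof (induction A rule: finite_ne_induct)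
    case (insert x A)
    then show ?case using lex_less_linear lex_less_trans by (metis insert_iff)
  qed auto
  then show ?thesis
    using assms by (metis finite_keys keys_eq_empty leading_def in_keys_iff lookup_zero poly_mapping_eqI empty_iff)
qed

text \<open>Choose at each stage a new element \<open>f i\<close> with lexicographically least
  leading exponent. By Dickson the leading monomial of some \<open>f i\<close> divides that of a
  later \<open>f j\<close>; subtracting a multiple of \<open>f i\<close> cancels the leading term of
  \<open>f j\<close> and leaves an element new at stage \<open>j\<close> with smaller leading
  exponent.\<close>

lemma ideal_chain_stable:
  fixes I :: "nat \<Rightarrow> ('v::finite, 'k::field) mpoly set"
  assumes ideal: "\<And>i. is_ideal (I i)" and strict: "\<And>i. I i \<subset> I (Suc i)"
  shows False
proof -
  have chain: "I i \<subseteq> I j" if "i \<le> j" for i j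
    using that
  proof (induction j)
    case (Suc j)
    then show ?case using strict[of j] by (cases "i = Suc j") auto
  qed simp
  define L where "L i = {\<mu>. \<exists>f \<in> I (Suc i) - I i. leading \<mu> f}" for i
  have "\<exists>\<mu>\<in>L i. \<forall>\<nu>\<in>L i. \<not> lex_less \<nu> \<mu>" for i
  proof -
    obtain f where f: "f \<in> I (Suc i) - I i" using strict[of i] by blast
    then have "f \<noteq> 0" using ideal_zero[OF ideal[of i]] by blast
    then obtain \<mu> where "\<mu> \<in> L i" using leading_ex f unfolding L_def by blast
    from wfE_min[OF wf_lex_less this] obtain \<rho> where "\<rho> \<in> L i"
      "\<And>\<nu>. (\<nu>, \<rho>) \<in> {(a, b). lex_less a b} \<Longrightarrow> \<nu> \<notin> L i" by blast
    then show ?thesis by (intro bexI[of _ \<rho>]) auto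
  qed
  then have "\<forall>i. \<exists>\<mu>. \<mu> \<in> L i \<and> (\<forall>\<nu>\<in>L i. \<not> lex_less \<nu> \<mu>)" by blast
  from choice[OF this] obtain \<mu> where \<mu>: "\<And>i. \<mu> i \<in> L i" "\<And>i \<nu>. \<nu> \<in> L i \<Longrightarrow> \<not> lex_less \<nu> (\<mu> i)"
    by blast
  then have "\<forall>i. \<exists>f. f \<in> I (Suc i) - I i \<and> leading (\<mu> i) f" unfolding L_def by blast
  from choice[OF this] obtain f where f: "\<And>i. f i \<in> I (Suc i) - I i" "\<And>i. leading (\<mu> i) (f i)"
    by blast
  obtain i j where ij: "i < j" "\<forall>v. Poly_Mapping.lookup (\<mu> i) v \<le> Poly_Mapping.lookup (\<mu> j) v"
    using dickson by blast
  define \<delta> where "\<delta> = \<mu> j - \<mu> i"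
  have \<delta>: "\<mu> j = \<delta> + \<mu> i"
    by (rule poly_mapping_eqI) (simp add: \<delta>_def lookup_add lookup_minus ij(2))
  define c where "c = Poly_Mapping.lookup (f j) (\<mu> j) / Poly_Mapping.lookup (f i) (\<mu> i)"
  define g where "g = f j - Poly_Mapping.single \<delta> c * f i"
  have "I (Suc i) \<subseteq> I j" using ij(1) by (intro chain) simp
  then have fi: "Poly_Mapping.single \<delta> c * f i \<in> I j" using f(1)[of i] by (intro ideal_mult_left ideal) auto
  have "g \<notin> I j"
  proof
    assume "g \<in> I j"
    then have "g + Poly_Mapping.single \<delta> c * f i \<in> I j" using fi by (intro ideal_add ideal)
    then show False using f(1)[of j] by (simp add: g_def)
  qed
  moreover have "g \<in> I (Suc j)"
    unfolding g_def using fi f(1)[of j] strict[of j] by (intro ideal_diff ideal) auto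
  ultimately have g: "g \<in> I (Suc j) - I j" by blast
  then have "g \<noteq> 0" using ideal_zero[OF ideal[of j]] by blast
  then obtain \<nu> where \<nu>: "leading \<nu> g" using leading_ex by blast
  then have "\<not> lex_less \<nu> (\<mu> j)" using \<mu>(2)[of \<nu> j] g unfolding L_def by blast
  have "\<nu> \<in> Poly_Mapping.keys g" using \<nu> by (simp add: leading_def)
  moreover have "Poly_Mapping.lookup (f i) (\<mu> i) \<noteq> 0" using f(2)[of i] by (simp add: leading_def in_keys_iff)
  then have "Poly_Mapping.lookup g (\<mu> j) = 0"
    by (simp add: g_def lookup_minus \<delta> lookup_single_mult) (simp add: c_def \<delta>)
  ultimately have "\<nu> \<noteq> \<mu> j" by (auto simp: in_keys_iff)
  have "\<nu> \<in> Poly_Mapping.keys (f j) \<or> \<nu> \<in> (+) \<delta> ` Poly_Mapping.keys (f i)"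
    using \<open>\<nu> \<in> Poly_Mapping.keys g\<close> keys_single_mult[of \<delta> c "f i"]
    unfolding g_def by (metis diff_self in_keys_iff lookup_minus subsetD)
  then have "\<nu> = \<mu> j \<or> lex_less \<nu> (\<mu> j)"
  proof
    assume "\<nu> \<in> Poly_Mapping.keys (f j)"
    then show ?thesis using f(2)[of j] unfolding leading_def by blast
  next
    assume "\<nu> \<in> (+) \<delta> ` Poly_Mapping.keys (f i)"
    then obtain \<rho> where \<rho>: "\<rho> \<in> Poly_Mapping.keys (f i)" "\<nu> = \<delta> + \<rho>" by blast
    then have "\<rho> = \<mu> i \<or> lex_less \<rho> (\<mu> i)" using f(2)[of i] unfolding leading_def by blast
    then show ?thesis unfolding \<rho>(2) \<delta> using lex_less_add by blast
  qed
  then show False using \<open>\<nu> \<noteq> \<mu> j\<close> \<open>\<not> lex_less \<nu> (\<mu> j)\<close> by blast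
qed

lemma ideal_maximal_element:
  fixes S :: "('v::finite, 'k::field) mpoly set set"
  assumes "S \<noteq> {}" "\<And>I. I \<in> S \<Longrightarrow> is_ideal I"
  shows "\<exists>M\<in>S. \<forall>N\<in>S. M \<subseteq> N \<longrightarrow> N = M"
proof -
  define R where "R = {(J, I). is_ideal (I :: ('v, 'k) mpoly set) \<and> is_ideal J \<and> I \<subset> J}"
  have "wf R"
    unfolding wf_iff_no_infinite_down_chain
  proof
    assume "\<exists>f. \<forall>i. (f (Suc i), f i) \<in> R"
    then obtain f where f: "\<forall>i. (f (Suc i), f i) \<in> R" ..
    have "is_ideal (f i)" "f i \<subset> f (Suc i)" for i
      using f[rule_format, of i] unfolding R_def by simp_all
    then show False by (rule ideal_chain_stable)
  qed
  obtain I where "I \<in> S" using assms(1) by blast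
  from wfE_min[OF \<open>wf R\<close> this] obtain M where M: "M \<in> S" "\<And>N. (N, M) \<in> R \<Longrightarrow> N \<notin> S"
    by blast
  show ?thesis
  proof (intro bexI[OF _ M(1)] ballI impI)
    fix N assume "N \<in> S" "M \<subseteq> N"
    then show "N = M" using M(2)[of N] assms(2)[of M] assms(2)[of N] M(1) unfolding R_def by blast
  qed
qed

text \<open>Among the proper colon ideals of \<open>J\<close> above the given one, a maximal one is
  prime: if \<open>b\<close> is outside \<open>(J : c')\<close>, then \<open>(J : b c')\<close> is
  again proper and contains it, so the two agree.\<close>

lemma colon_subset_prime:
  fixes J :: "('v::finite, 'k::field) mpoly set"
  assumes J: "is_ideal J" and c: "c \<notin> J"
  obtains c' where "is_prime_ideal {g. g * c' \<in> J}" "{g. g * c \<in> J} \<subseteq> {g. g * c' \<in> J}"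
proof -
  define S where "S = {{g. g * c' \<in> J} | c'. c' \<notin> J \<and> {g. g * c \<in> J} \<subseteq> {g. g * c' \<in> J}}"
  have "S \<noteq> {}" using c unfolding S_def by blast
  moreover have "is_ideal I" if "I \<in> S" for I
    using that is_ideal_colon[OF J] unfolding S_def by blast
  ultimately obtain M where M: "M \<in> S" "\<forall>N\<in>S. M \<subseteq> N \<longrightarrow> N = M"
    using ideal_maximal_element by meson
  obtain c' where c': "M = {g. g * c' \<in> J}" "c' \<notin> J" "{g. g * c \<in> J} \<subseteq> {g. g * c' \<in> J}"
    using M(1) unfolding S_def by blast
  have "is_prime_ideal {g. g * c' \<in> J}"
    unfolding is_prime_ideal_def
  proof (intro conjI allI impI)
    show "is_ideal {g. g * c' \<in> J}" by (rule is_ideal_colon[OF J])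
    have "1 \<notin> {g. g * c' \<in> J}" using c'(2) by simp
    then show "{g. g * c' \<in> J} \<noteq> UNIV" by blast
    fix a b assume ab: "a * b \<in> {g. g * c' \<in> J}"
    show "a \<in> {g. g * c' \<in> J} \<or> b \<in> {g. g * c' \<in> J}"
    proof (rule disjCI)
      assume "b \<notin> {g. g * c' \<in> J}"
      then have b: "b * c' \<notin> J" by simp
      have sub: "{g. g * c' \<in> J} \<subseteq> {g. g * (b * c') \<in> J}"
      proof safe
        fix x assume "x * c' \<in> J"
        then have "b * (x * c') \<in> J" by (rule ideal_mult_left[OF J])
        then show "x * (b * c') \<in> J" by (simp add: mult.left_commute)
      qed
      then have "{g. g * (b * c') \<in> J} \<in> S" using b c'(3) unfolding S_def by blast
      then have "{g. g * (b * c') \<in> J} = M" using M(2) sub c'(1) by blast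
      moreover have "a \<in> {g. g * (b * c') \<in> J}" using ab by (simp add: mult.assoc)
      ultimately show "a \<in> {g. g * c' \<in> J}" using c'(1) by blast
    qed
  qed
  then show thesis using that c'(3) by blast
qed

text \<open>The powers of \<open>J\<close> are unmixed, and no prime associated to \<open>J\<close> contains \<open>K\<close>.\<close>
lemma symbolic_pow_Int_subset:
  fixes fs gs :: "('v::finite, 'k::field) mpoly list"
  assumes reg: "weakly_regular {} (gs @ fs)" and "gs \<noteq> []"
  defines "J \<equiv> ideal_gen (set fs)" and "K \<equiv> ideal_gen (set gs)"
  shows "symbolic_pow (J \<inter> K) m \<subseteq> ideal_pow J m"
proof
  fix u assume u: "u \<in> symbolic_pow (J \<inter> K) m"
  have J: "is_ideal J" and K: "is_ideal K" by (simp_all add: J_def K_def)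
  obtain hs g where gs: "gs = hs @ [g]" using \<open>gs \<noteq> []\<close> by (metis rev_exhaust)
  have "weakly_regular {} (g # fs)" using reg unfolding gs by (simp add: weakly_regular_append)
  then have fs: "weakly_regular {} fs" and g_reg: "\<And>x. g * x \<in> J \<Longrightarrow> x \<in> J"
    using weakly_regular_ConsD[of "{}" g fs] unfolding J_def by (simp_all only: weakly_regular.simps Un_empty_left)
  have g: "g \<in> K" unfolding K_def gs by (rule in_ideal_genI) simp
  show "u \<in> ideal_pow J m"
  proof (rule ccontr)
    assume "u \<notin> ideal_pow J m"
    \<comment> \<open>Since \<open>J ^ 0\<close> is the whole ring there is such an
      \<open>i\<close>. In layer \<open>i\<close> the class of \<open>u\<close> is nonzero, hence
      some coefficient is outside \<open>J\<close>.\<close>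
    then obtain i where i: "i < m" "u \<in> ideal_pow J i" "u \<notin> ideal_pow J (Suc i)"
      using ex_least_nat_less[of "\<lambda>i. u \<notin> ideal_pow J i" m] by auto
    obtain es where es: "free_layer J i es" using weakly_regular_free_layer[OF fs] unfolding J_def by blast
    obtain c where c: "u = (\<Sum>j<length es. c j * es ! j)" using free_layer_sum[OF es i(2)] .
    obtain j where j: "j < length es" "c j \<notin> J"
      using free_layer_sum_in[OF es J, of c] i(3) unfolding c by auto
    obtain c' where prime: "is_prime_ideal {x. x * c' \<in> J}" and sub: "{x. x * c j \<in> J} \<subseteq> {x. x * c' \<in> J}"
      using colon_subset_prime[OF J j(2)] by blast
    \<comment> \<open>Multiplication by \<open>g\<close> lands in \<open>K\<close> and is injective
      modulo \<open>J\<close>. So the prime \<open>(J : c')\<close> equals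
      \<open>(J \<inter> K : g c')\<close> and is associated to \<open>J \<inter> K\<close> as
      well.\<close>
    have "x * c' \<in> J \<longleftrightarrow> x * (g * c') \<in> J \<inter> K" for x
      using g_reg[of "x * c'"] ideal_mult_left[OF J, of "x * c'" g] ideal_mult_left[OF K g, of "x * c'"]
      by (auto simp: mult_ac)
    then have "{x. x * c' \<in> J} = {x. x * (g * c') \<in> J \<inter> K}" by blast
    then have "{x. x * c' \<in> J} \<in> ass_primes (J \<inter> K)"
      using prime unfolding ass_primes_def by blast
    then have "u \<in> loc_contract (ideal_pow (J \<inter> K) m) {x. x * c' \<in> J}"
      using u unfolding symbolic_pow_def by blast
    then obtain s where s: "s * c' \<notin> J" "s * u \<in> ideal_pow (J \<inter> K) m"
      unfolding loc_contract_def by blast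
    \<comment> \<open>Independence in layer \<open>i\<close> turns \<open>s * u\<close> in
      \<open>J ^ (i + 1)\<close> into \<open>s * c j\<close> in \<open>J\<close>. Then
      \<open>s\<close> lies in \<open>(J : c j)\<close> and therefore in the prime that it was
      chosen to avoid.\<close>
    have "ideal_pow (J \<inter> K) m \<subseteq> ideal_pow J m" by (rule ideal_pow_mono) simp
    also have "\<dots> \<subseteq> ideal_pow J (Suc i)" using i(1) by (intro ideal_pow_antimono) simp
    finally have "s * u \<in> ideal_pow J (Suc i)" using s(2) by blast
    then have "(\<Sum>j<length es. (s * c j) * es ! j) \<in> ideal_pow J (Suc i)"
      by (simp add: c sum_distrib_left mult.assoc)
    then have "s * c j \<in> J" using j(1) by (rule free_layerD[OF es, where c = "\<lambda>j. s * c j"])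
    then show False using sub s(1) by blast
  qed
qed

lemma ideal_pow_subset_symbolic_pow: "ideal_pow I m \<subseteq> symbolic_pow I m"
proof
  fix u assume "u \<in> ideal_pow I m"
  moreover have "1 \<notin> P" if "P \<in> ass_primes I" for P
    using that ideal_UNIV_iff[of P] by (auto simp: ass_primes_def is_prime_ideal_def)
  ultimately show "u \<in> symbolic_pow I m"
    unfolding symbolic_pow_def loc_contract_def by (auto intro!: exI[of _ 1])
qed

subsection \<open>Complete intersections\<close>

text \<open>A nonzero form of degree 0 is a unit and lies in no proper ideal.\<close>

lemma homogeneous_positive_form:
  fixes f :: "('v::finite, 'k::field) mpoly"
  assumes "homogeneous f" "f \<in> I" "is_ideal I" "I \<noteq> UNIV"
  shows "positive_form f"
proof (cases "f = 0")
  case True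
  then show ?thesis by (auto simp: positive_form_def has_degree_def)
next
  case False
  obtain d where d: "has_degree d f" using assms(1) by (auto simp: homogeneous_def has_degree_def)
  have "d \<noteq> 0"
  proof
    assume "d = 0"
    have "\<mu> = 0" if "\<mu> \<in> Poly_Mapping.keys f" for \<mu>
      using d that \<open>d = 0\<close> by (intro poly_mapping_eqI) (auto simp: has_degree_def mono_deg_def)
    then have f: "f = Poly_Mapping.single 0 (Poly_Mapping.lookup f 0)"
      by (intro poly_mapping_eqI) (auto simp: lookup_single when_def in_keys_iff)
    then have "Poly_Mapping.lookup f 0 \<noteq> 0" using False by auto
    then have "f dvd 1" using single_zero_dvd_one f by metis
    then obtain x where "1 = f * x" by (elim dvdE)
    then have "1 \<in> I" using ideal_mult_right[OF assms(3,2), of x] by simp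
    then show False using assms(3,4) ideal_UNIV_iff by blast
  qed
  then show ?thesis using d unfolding positive_form_def by (intro exI[of _ d]) simp
qed

text \<open>Polynomials without constant term form an ideal.\<close>

lemma positive_forms_proper:
  assumes "\<forall>h\<in>set hs. positive_form h"
  shows "1 \<notin> ideal_gen (set hs)"
proof -
  let ?K = "{f :: ('a, 'b) mpoly. \<forall>\<mu>\<in>Poly_Mapping.keys f. \<mu> \<noteq> 0}"
  have "is_ideal ?K"
    unfolding is_ideal_def
  proof (intro conjI ballI allI)
    fix a b assume "a \<in> ?K" "b \<in> ?K"
    then show "a + b \<in> ?K" using keys_add[of a b] by blast
  next
    fix a r assume a: "a \<in> ?K"
    show "r * a \<in> ?K"
    proof safe
      assume "0 \<in> Poly_Mapping.keys (r * a)"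
      then obtain x y where xy: "0 = x + y" "y \<in> Poly_Mapping.keys a" using keys_mult[of r a] by blast
      then have "Poly_Mapping.lookup y v = 0" for v
        using lookup_add[of x y v] by simp
      then have "y = 0" by (intro poly_mapping_eqI) simp
      then show False using a xy(2) by blast
    qed
  qed simp
  moreover have "set hs \<subseteq> ?K"
    using assms by (fastforce simp: positive_form_def has_degree_def mono_deg_def)
  ultimately have "ideal_gen (set hs) \<subseteq> ?K" by (rule ideal_gen_minimal)
  then show ?thesis by auto
qed

theorem theorem3p3:
  fixes r :: nat
    and J1 J2 :: "('v::finite, 'k::field_char_0) mpoly set"
  assumes "alg_closed_field TYPE('k)"
    and "card (UNIV :: 'v set) = 2 * r + 2"
    and "complete_intersection_ideal r J1"
    and "complete_intersection_ideal r J2"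
    and "disjoint_subschemes J1 J2"
  shows "\<forall>m::nat. m \<ge> 1 \<longrightarrow> ideal_pow (J1 \<inter> J2) m = symbolic_pow (J1 \<inter> J2) m"
proof (intro allI impI)
  fix m :: nat
  have ci: "\<exists>fs. regular_sequence fs \<and> J = ideal_gen (set fs) \<and> length fs \<le> r + 1 \<and>
      (\<forall>f\<in>set fs. positive_form f)" if J: "complete_intersection_ideal r J" for J :: "('v, 'k) mpoly set"
  proof -
    obtain fs where fs: "\<forall>f\<in>set fs. homogeneous f" "regular_sequence fs" "J = ideal_gen (set fs)"
      and "prime_chain_above J (r + 1)"
      using J unfolding complete_intersection_ideal_def krull_dim_quot_eq_def by blast
    then have "length fs + (r + 1) \<le> 2 * r + 2"
      using regular_sequence_prime_chain[OF fs(2)] assms(2) by metis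
    moreover have "positive_form f" if "f \<in> set fs" for f
      using fs(1,2) that in_ideal_genI[of f "set fs"] homogeneous_positive_form[of f "ideal_gen (set fs)"]
      by (simp add: regular_sequence_def)
    ultimately show ?thesis using fs by auto
  qed
  obtain fs where fs: "regular_sequence fs" "J1 = ideal_gen (set fs)" "length fs \<le> r + 1"
    "\<forall>f\<in>set fs. positive_form f"
    using ci[OF assms(3)] by blast
  obtain gs where gs: "regular_sequence gs" "J2 = ideal_gen (set gs)" "length gs \<le> r + 1"
    "\<forall>g\<in>set gs. positive_form g"
    using ci[OF assms(4)] by blast
  obtain vs :: "'v list" where vs: "set vs = UNIV" "distinct vs"
    using finite_distinct_list[OF finite] by blast
  have len_vs: "length vs = 2 * r + 2" using distinct_card[OF vs(2)] vs(1) assms(2) by simp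
  have "1 \<in> saturation (ideal_gen (J1 \<union> J2))"
    using assms(5) unfolding disjoint_subschemes_def by simp
  then obtain n where n: "\<forall>g\<in>ideal_pow irrelevant n. g \<in> ideal_gen (J1 \<union> J2)"
    unfolding saturation_def by auto
  \<comment> \<open>One power for each variable, so \<open>length ys\<close> is exactly 2r + 2. The
    case \<open>n = 0\<close> needs no separate treatment, as weak regularity tolerates the unit
    ideal.\<close>
  define ys where "ys = map (\<lambda>v. var v ^ n :: ('v, 'k) mpoly) vs"
  have ys: "weakly_regular {} ys" unfolding ys_def by (rule weakly_regular_var_powers[OF vs(2)])
  have "ideal_gen (J1 \<union> J2) = ideal_gen (set fs \<union> set gs)"
    unfolding fs(2) gs(2) ideal_gen_gen_Un ideal_gen_Un_gen ..
  moreover have "var v ^ n \<in> ideal_pow (irrelevant :: ('v, 'k) mpoly set) n" for v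
    unfolding irrelevant_def by (intro power_in_ideal_pow in_ideal_genI) auto
  ultimately have ys_sub: "set ys \<subseteq> ideal_gen (set fs \<union> set gs)"
    using n unfolding ys_def by auto
  \<comment> \<open>The two length bounds are used in opposite directions: at most 2r + 2 forms give
    acyclicity and so regularity, while properness of their ideal forces at least 2r + 2 of them.
    Any arrangement \<open>hs\<close> is allowed, so both orders follow.\<close>
  have reg: "weakly_regular {} hs" and long: "2 * r + 2 \<le> length hs"
    if hs: "set hs = set fs \<union> set gs" "length hs = length fs + length gs" for hs
  proof -
    have pos: "\<forall>h\<in>set hs. positive_form h" using fs(4) gs(4) hs(1) by auto
    have sub: "set ys \<subseteq> ideal_gen (set hs)" using ys_sub hs(1) by simp
    have "length hs \<le> length ys" using fs(3) gs(3) hs(2) len_vs by (simp add: ys_def)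
    then show "weakly_regular {} hs"
      using koszul_acyclic_weakly_regular[OF koszul_acyclic_depth[OF ys sub]] pos by blast
    show "2 * r + 2 \<le> length hs"
      using koszul_depth_zero[OF ys sub positive_forms_proper[OF pos]] len_vs by (simp add: ys_def)
  qed
  have gf: "weakly_regular {} (rev gs @ rev fs)" and fg: "weakly_regular {} (rev fs @ rev gs)"
    by (rule reg; auto)+
  \<comment> \<open>Together with the bounds r + 1 this makes both lengths equal to r + 1, so
    neither list is empty and each ideal supplies an element regular modulo the other.\<close>
  have "2 * r + 2 \<le> length (rev gs @ rev fs)" by (rule long) auto
  then have ne: "rev fs \<noteq> []" "rev gs \<noteq> []" using fs(3) gs(3) by auto
  have "symbolic_pow (J1 \<inter> J2) m \<subseteq> ideal_pow J1 m \<inter> ideal_pow J2 m"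
    using symbolic_pow_Int_subset[OF gf ne(2), of m] symbolic_pow_Int_subset[OF fg ne(1), of m]
    by (simp add: fs(2) gs(2) Int_commute)
  also have "\<dots> \<subseteq> ideal_pow (J1 \<inter> J2) m"
    using weakly_regular_pow_Int_pow[OF gf regular_sequence_imp_weakly_regular[OF gs(1)], of m]
    by (simp add: fs(2) gs(2))
  finally show "ideal_pow (J1 \<inter> J2) m = symbolic_pow (J1 \<inter> J2) m"
    using ideal_pow_subset_symbolic_pow by blast
qed

end
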